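(* Let $\mathcal I_{\mathbb Z}=[0,N]\cap\mathbb Z$ be a finite discrete interval, let matrices $\alpha,\beta\in\Gamma$ be given, and let $\mathcal S_k,\mathcal V_k$ be $2n\times 2n$ complex-valued matrices such that $\mathcal S_k^*\mathcal J\mathcal S_k=\mathcal J$, $\mathcal V_k^*\mathcal J\mathcal S_k$ is Hermitian, $\mathcal V_k^*\mathcal J\mathcal V_k=0$, and $\Psi_k:=\mathcal J\mathcal S_k\mathcal J\mathcal V_k^*\mathcal J\ge 0$ for all $k\in\mathcal I_{\mathbb Z}$. Then the number of all linearly independent eigenfunctions of system $(\mathrm S_\lambda)$, denoted by $r$, is finite and satisfies the estimate $$0\le r\le 2n(N+2).$$ If, in addition, the Weak Atkinson condition is satisfied, then we have yet another upper bound $$r\le \min\Big\{n(N+1),\ \sum_{k\in\mathcal I_{\mathbb Z}}\operatorname{rank}\Psi_k\Big\}.$$ Furthermore (still under the Weak Atkinson condition), for any sequence $\{f_k\}_{k=0}^{N+1}$ in $\mathbb C^{2n}$, any solution $\hat z=\{\hat z_k\}_{k=0}^{N+1}$ of the boundary value problem $$\mathcal J[z_k-\mathcal S_k z_{k+1}]=\Psi_k f_k,\quad k\in\mathcal I_{\mathbb Z},\qquad \alpha z_0=0=\beta z_{N+1},$$ admits the representation as the finite sum $\sum_{j=1}^r c_j z^{[j]}$ in the sense $$\Big\|\hat z-\sum_{j=1}^r c_j z^{[j]}\Big\|_\Psi=0,$$ where $c_j:=\sum_{k\in\mathcal I_{\mathbb Z}} z_k^{[j]*}\Psi_k\hat z_k$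 for all $j=1,\dots,r$, with $z^{[1]},\dots,z^{[r]}$ being linearly independent eigenfunctions of system $(\mathrm S_\lambda)$.
   Context: Notation: $n\in\mathbb N$, $N\in\{0,1,2,\dots\}$; $\mathcal J=\begin{pmatrix}0&-I_n\\ I_n&0\end{pmatrix}$; $M^*$ is the conjugate transpose of $M$; $\Gamma=\{\alpha\in\mathbb C^{n\times 2n}: \alpha\alpha^*=I_n,\ \alpha\mathcal J\alpha^*=0\}$. For $\lambda\in\mathbb C$, system $(\mathrm S_\lambda)$ is $z_k=(\mathcal S_k+\lambda\mathcal V_k)z_{k+1}$, $k\in\mathcal I_{\mathbb Z}$, for sequences $z=\{z_k\}_{k=0}^{N+1}$ in $\mathbb C^{2n}$ (or in $\mathbb C^{2n\times m}$). Under the stated assumptions $\mathcal S_k+\lambda\mathcal V_k$ is invertible, so initial value problems have unique solutions on $[0,N+1]\cap\mathbb Z$. An eigenfunction of $(\mathrm S_\lambda)$ is a nontrivial sequence $z$ which, for some $\lambda\in\mathbb C$, solves $(\mathrm S_\lambda)$ and satisfies $\alpha z_0=0=\beta z_{N+1}$; the number $r$ counts linearly independent eigenfunctions over all $\lambda\in\mathbb C$. Semi-inner product and semi-norm: $\langle z,u\rangle_\Psi=\sum_{k\in\mathcal I_{\mathbb Z}}z_k^*\Psi_k u_k$, $\|z\|_\Psi=\sqrt{\langle z,z\rangle_\Psi}$. Let $\tilde Z(\lambda)$ be the $2n\times n$ matrix solution of $(\mathrm S_\lambda)$ with $\tilde Z_0(\lambda)=-\mathcal J\alpha^*$. Weak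 Atkinson condition (for the given $\alpha$): there exists $\lambda\in\mathbb C$ such that every nontrivial linear combination $z=\tilde Z(\lambda)\eta$, $0\ne\eta\in\mathbb C^n$, of the columns of $\tilde Z(\lambda)$ satisfies $\sum_{k=0}^N z_k^*\Psi_k z_k>0$.
   Formalization: The linearly independent eigenfunctions z^[1],…,z^[r] in the expansion are taken orthonormal for the semi-inner product (such a system is proved to exist), since with the stated c_j the representation fails for other systems, e.g. after rescaling an eigenfunction. *)

theory Defs
  imports
    "HOL-Analysis.Analysis"
    "HOL-Library.Complex_Order"
    "HOL-Library.Extended_Nat"
    "HOL-Library.Function_Algebras"
begin

text \<open>The space of 2n-vectors is \<open>complex ^ ('n + 'n)\<close> with n = \<open>CARD('n)\<close>: \<open>Inl\<close> indexes the upper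
  and \<open>Inr\<close> the lower block.\<close>

definition conj_transpose :: "complex ^ 'n ^ 'm \<Rightarrow> complex ^ 'm ^ 'n" where
  "conj_transpose A = (\<chi> i j. cnj (A $ j $ i))"

definition hermitian :: "complex ^ 'n ^ 'n \<Rightarrow> bool" where
  "hermitian A \<longleftrightarrow> conj_transpose A = A"

definition cdot :: "complex ^ 'n \<Rightarrow> complex ^ 'n \<Rightarrow> complex" where
  "cdot x y = (\<Sum>i\<in>UNIV. cnj (x $ i) * y $ i)"

text \<open>The order on \<^typ>\<open>complex\<close> is the one of \<^theory>\<open>HOL-Library.Complex_Order\<close>:
  \<open>0 \<le> w\<close> (\<open>0 < w\<close>) says that \<open>w\<close> is real and nonnegative (positive).\<close>

definition pos_semidef :: "complex ^ 'n ^ 'n \<Rightarrow> bool" where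
  "pos_semidef A \<longleftrightarrow> hermitian A \<and> (\<forall>x. 0 \<le> cdot x (A *v x))"

definition scale_mat :: "complex \<Rightarrow> complex ^ 'n ^ 'm \<Rightarrow> complex ^ 'n ^ 'm" where
  "scale_mat c A = (\<chi> i j. c * A $ i $ j)"

definition Jmat :: "complex ^ ('n::finite + 'n) ^ ('n + 'n)" where
  "Jmat = (\<chi> i j. case (i, j) of
      (Inl a, Inr b) \<Rightarrow> - (if a = b then 1 else 0)
    | (Inr a, Inl b) \<Rightarrow> (if a = b then 1 else 0)
    | _ \<Rightarrow> 0)"

definition Gam :: "(complex ^ ('n::finite + 'n) ^ 'n) set" where
  "Gam = {\<alpha>. \<alpha> ** conj_transpose \<alpha> = mat 1 \<and> \<alpha> ** Jmat ** conj_transpose \<alpha> = 0}"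

definition Psi ::
  "(nat \<Rightarrow> complex ^ ('n::finite + 'n) ^ ('n + 'n)) \<Rightarrow> (nat \<Rightarrow> complex ^ ('n + 'n) ^ ('n + 'n)) \<Rightarrow>
   nat \<Rightarrow> complex ^ ('n + 'n) ^ ('n + 'n)" where
  "Psi S V k = Jmat ** S k ** Jmat ** conj_transpose (V k) ** Jmat"

definition semi_inner ::
  "(nat \<Rightarrow> complex ^ 'd ^ 'd) \<Rightarrow> nat \<Rightarrow> (nat \<Rightarrow> complex ^ 'd) \<Rightarrow> (nat \<Rightarrow> complex ^ 'd) \<Rightarrow> complex" where
  "semi_inner P N z u = (\<Sum>k\<in>{0..N}. cdot (z k) (P k *v u k))"

definition semi_norm ::
  "(nat \<Rightarrow> complex ^ 'd ^ 'd) \<Rightarrow> nat \<Rightarrow> (nat \<Rightarrow> complex ^ 'd) \<Rightarrow> real" where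
  "semi_norm P N z = sqrt (Re (semi_inner P N z z))"

definition solves_S ::
  "(nat \<Rightarrow> complex ^ 'd ^ 'd) \<Rightarrow> (nat \<Rightarrow> complex ^ 'd ^ 'd) \<Rightarrow> nat \<Rightarrow> complex \<Rightarrow>
   (nat \<Rightarrow> complex ^ 'd) \<Rightarrow> bool" where
  "solves_S S V N l z \<longleftrightarrow> (\<forall>k\<in>{0..N}. z k = (S k + scale_mat l (V k)) *v z (k + 1))"

definition solves_S_mat ::
  "(nat \<Rightarrow> complex ^ 'd ^ 'd) \<Rightarrow> (nat \<Rightarrow> complex ^ 'd ^ 'd) \<Rightarrow> nat \<Rightarrow> complex \<Rightarrow>
   (nat \<Rightarrow> complex ^ 'm ^ 'd) \<Rightarrow> bool" where
  "solves_S_mat S V N l Z \<longleftrightarrow> (\<forall>k\<in>{0..N}. Z k = (S k + scale_mat l (V k)) ** Z (k + 1))"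

text \<open>A sequence on \<open>{0..N+1}\<close> is encoded as the function on \<^typ>\<open>nat\<close> extending it by zero, so that
  equality and linear independence of such functions are those of the finite sequences.\<close>

definition eigenfunctions ::
  "(nat \<Rightarrow> complex ^ ('n::finite + 'n) ^ ('n + 'n)) \<Rightarrow> (nat \<Rightarrow> complex ^ ('n + 'n) ^ ('n + 'n)) \<Rightarrow> nat \<Rightarrow>
   complex ^ ('n + 'n) ^ 'n \<Rightarrow> complex ^ ('n + 'n) ^ 'n \<Rightarrow> (nat \<Rightarrow> complex ^ ('n + 'n)) set" where
  "eigenfunctions S V N \<alpha> \<beta> = {z. (\<forall>k > N + 1. z k = 0) \<and> (\<exists>k \<le> N + 1. z k \<noteq> 0) \<and>
     (\<exists>l. solves_S S V N l z) \<and> \<alpha> *v z 0 = 0 \<and> \<beta> *v z (N + 1) = 0}"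

definition seq_scale :: "complex \<Rightarrow> (nat \<Rightarrow> complex ^ 'd) \<Rightarrow> nat \<Rightarrow> complex ^ 'd" where
  "seq_scale c z = (\<lambda>k. c *s z k)"

global_interpretation cseq: vector_space "seq_scale :: complex \<Rightarrow> (nat \<Rightarrow> complex ^ 'd) \<Rightarrow> _"
  by standard (auto simp: seq_scale_def fun_eq_iff vec_eq_iff algebra_simps)

text \<open>The maximal number of linearly independent eigenfunctions, all eigenvalues taken together; a
  priori possibly infinite.\<close>

definition num_eigenfunctions ::
  "(nat \<Rightarrow> complex ^ ('n::finite + 'n) ^ ('n + 'n)) \<Rightarrow> (nat \<Rightarrow> complex ^ ('n + 'n) ^ ('n + 'n)) \<Rightarrow> nat \<Rightarrow>
   complex ^ ('n + 'n) ^ 'n \<Rightarrow> complex ^ ('n + 'n) ^ 'n \<Rightarrow> enat" where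
  "num_eigenfunctions S V N \<alpha> \<beta> =
     (SUP B \<in> {B. B \<subseteq> eigenfunctions S V N \<alpha> \<beta> \<and> cseq.independent B}.
        if finite B then enat (card B) else \<infinity>)"

text \<open>\<open>Z\<close> is determined on \<open>{0..N+1}\<close> by its initial value whenever the coefficient matrices
  \<open>S k + scale_mat l (V k)\<close> are invertible. This is the case for all \<open>l\<close> under the standing assumptions
  on \<open>S\<close> and \<open>V\<close>.\<close>

definition weak_atkinson ::
  "(nat \<Rightarrow> complex ^ ('n::finite + 'n) ^ ('n + 'n)) \<Rightarrow> (nat \<Rightarrow> complex ^ ('n + 'n) ^ ('n + 'n)) \<Rightarrow> nat \<Rightarrow>
   complex ^ ('n + 'n) ^ 'n \<Rightarrow> bool" where
  "weak_atkinson S V N \<alpha> \<longleftrightarrow>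
     (\<exists>l Z. solves_S_mat S V N l Z \<and> Z 0 = - (Jmat ** conj_transpose \<alpha>) \<and>
        (\<forall>\<eta>::complex ^ 'n. \<eta> \<noteq> 0 \<longrightarrow>
           0 < semi_inner (Psi S V) N (\<lambda>k. Z k *v \<eta>) (\<lambda>k. Z k *v \<eta>)))"

definition solves_bvp ::
  "(nat \<Rightarrow> complex ^ ('n::finite + 'n) ^ ('n + 'n)) \<Rightarrow> (nat \<Rightarrow> complex ^ ('n + 'n) ^ ('n + 'n)) \<Rightarrow> nat \<Rightarrow>
   complex ^ ('n + 'n) ^ 'n \<Rightarrow> complex ^ ('n + 'n) ^ 'n \<Rightarrow>
   (nat \<Rightarrow> complex ^ ('n + 'n)) \<Rightarrow> (nat \<Rightarrow> complex ^ ('n + 'n)) \<Rightarrow> bool" where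
  "solves_bvp S V N \<alpha> \<beta> f z \<longleftrightarrow>
     (\<forall>k\<in>{0..N}. Jmat *v (z k - S k *v z (k + 1)) = Psi S V k *v f k) \<and>
     \<alpha> *v z 0 = 0 \<and> \<beta> *v z (N + 1) = 0"

text \<open>Systems \<open>z 1, \<dots>, z r\<close> of linearly independent eigenfunctions, orthonormal with respect to the
  semi-inner product. The normalisation is what makes \<open>semi_inner (Psi S V) N (z j) zh\<close> the right
  coefficients of an expansion.\<close>

definition orthonormal_eigensystem ::
  "(nat \<Rightarrow> complex ^ ('n::finite + 'n) ^ ('n + 'n)) \<Rightarrow> (nat \<Rightarrow> complex ^ ('n + 'n) ^ ('n + 'n)) \<Rightarrow> nat \<Rightarrow>
   complex ^ ('n + 'n) ^ 'n \<Rightarrow> complex ^ ('n + 'n) ^ 'n \<Rightarrow> nat \<Rightarrow>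
   (nat \<Rightarrow> nat \<Rightarrow> complex ^ ('n + 'n)) \<Rightarrow> bool" where
  "orthonormal_eigensystem S V N \<alpha> \<beta> r z \<longleftrightarrow>
     z ` {1..r} \<subseteq> eigenfunctions S V N \<alpha> \<beta> \<and>
     inj_on z {1..r} \<and> cseq.independent (z ` {1..r}) \<and>
     (\<forall>i\<in>{1..r}. \<forall>j\<in>{1..r}. semi_inner (Psi S V) N (z i) (z j) = (if i = j then 1 else 0))"

end

theory Submission
  imports Defs "HOL-Computational_Algebra.Fundamental_Theorem_Algebra"
begin

text \<open>
  By \<open>\<Psi> k ** S k = Jmat ** V k\<close> and \<open>\<Psi> k ** Jmat ** \<Psi> k = 0\<close>, the eigenfunctions are the nonzero \<open>z\<close> for which
  the inhomogeneous problem with right-hand side \<open>\<lambda> z\<close> has the solution \<open>z\<close>, and the Lagrange identity makes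
  this problem a symmetric linear relation for the semi-inner product. Under the weak Atkinson condition no
  eigenfunction is null, so eigenvalues are real, eigenspaces are orthogonal, and an orthonormal system of
  eigenfunctions spans all of them; \<open>z \<mapsto> (\<Psi> k *v z k)\<close> is injective on this span, which bounds \<open>r\<close> by
  the ranks. Some real \<open>l\<close> is not an eigenvalue, and the relation then has a resolvent \<open>R\<close> at \<open>l\<close>, which
  is symmetric and has the eigenfunctions as its eigenvectors with nonzero eigenvalue. Hence \<open>R\<close> has no nonzero
  eigenvalue on the orthogonal complement of the eigenfunctions and is nilpotent there; being symmetric, it then
  takes only null values there. As all solutions of inhomogeneous problems lie in the range of \<open>R\<close>, the
  expansion follows.
\<close>

section \<open>Vectors and matrices\<close>

lemma matrix_vector_mult_minus_left: "(- A) *v x = - (A *v x)" for A :: "complex ^ 'n ^ 'm"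
  by (simp add: matrix_vector_mult_def vec_eq_iff sum_negf)

lemma matrix_vector_mult_minus_right: "A *v (- x) = - (A *v x)" for A :: "complex ^ 'n ^ 'm"
  by (metis diff_0 matrix_vector_mult_0_right matrix_vector_mult_diff_distrib)

lemma conj_transpose_conj_transpose [simp]: "conj_transpose (conj_transpose A) = A"
  by (simp add: conj_transpose_def vec_eq_iff)

lemma conj_transpose_mult: "conj_transpose (A ** B) = conj_transpose B ** conj_transpose A"
  by (simp add: conj_transpose_def matrix_matrix_mult_def vec_eq_iff mult.commute)

lemma conj_transpose_Jmat: "conj_transpose Jmat = - Jmat"
  by (auto simp: conj_transpose_def Jmat_def vec_eq_iff split: sum.splits)

lemma scale_mat_vec: "scale_mat c A *v x = c *s (A *v x)"
  by (simp add: scale_mat_def matrix_vector_mult_def vec_eq_iff sum_distrib_left mult.assoc)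

lemma sum_UNIV_sum_type:
  "(\<Sum>i\<in>UNIV. f i) = (\<Sum>a\<in>UNIV. f (Inl a)) + (\<Sum>b\<in>UNIV. f (Inr b))"
  for f :: "'a::finite + 'b::finite \<Rightarrow> 'c::comm_monoid_add"
  by (subst UNIV_Plus_UNIV [symmetric], subst sum.Plus) simp_all

lemma Jmat_vec:
  "Jmat *v x = (\<chi> i. case i of Inl a \<Rightarrow> - x $ Inr a | Inr a \<Rightarrow> x $ Inl a)"
  for x :: "complex ^ ('n::finite + 'n)"
  by (simp add: vec_eq_iff matrix_vector_mult_def Jmat_def sum_UNIV_sum_type if_distribR sum_negf
      if_distrib [where f = "\<lambda>x. x * _"] if_distrib [where f = uminus] cong: if_cong split: sum.splits)

lemma Jmat_Jmat_vec [simp]: "Jmat *v (Jmat *v x) = - x"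
  for x :: "complex ^ ('n::finite + 'n)"
  by (simp add: Jmat_vec vec_eq_iff split: sum.splits)

lemma Jmat_eq_iff: "Jmat *v x = y \<longleftrightarrow> x = - (Jmat *v y)" for x :: "complex ^ ('n::finite + 'n)"
  by (metis Jmat_Jmat_vec matrix_vector_mult_minus_right minus_equation_iff)

section \<open>The complex inner product and semidefinite matrices\<close>

lemma cdot_add_left: "cdot (x + y) z = cdot x z + cdot y z"
  by (simp add: cdot_def algebra_simps sum.distrib)

lemma cdot_add_right: "cdot x (y + z) = cdot x y + cdot x z"
  by (simp add: cdot_def algebra_simps sum.distrib)

lemma cdot_diff_left: "cdot (x - y) z = cdot x z - cdot y z"
  by (simp add: cdot_def algebra_simps sum_subtractf)

lemma cdot_diff_right: "cdot x (y - z) = cdot x y - cdot x z"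
  by (simp add: cdot_def algebra_simps sum_subtractf)

lemma cdot_minus_left [simp]: "cdot (- x) z = - cdot x z"
  by (simp add: cdot_def sum_negf)

lemma cdot_minus_right [simp]: "cdot x (- z) = - cdot x z"
  by (simp add: cdot_def sum_negf)

lemma cdot_scale_left: "cdot (c *s x) y = cnj c * cdot x y"
  by (simp add: cdot_def sum_distrib_left algebra_simps)

lemma cdot_scale_right: "cdot x (c *s y) = c * cdot x y"
  by (simp add: cdot_def sum_distrib_left algebra_simps)

lemma cdot_zero_left [simp]: "cdot 0 y = 0"
  by (simp add: cdot_def)

lemma cdot_zero_right [simp]: "cdot y 0 = 0"
  by (simp add: cdot_def)

lemma cdot_commute: "cdot y x = cnj (cdot x y)"
  by (simp add: cdot_def mult.commute)

lemma cdot_self: "cdot x x = of_real (\<Sum>i\<in>UNIV. (cmod (x $ i))\<^sup>2)"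
  unfolding cdot_def of_real_sum by (simp only: complex_norm_square mult.commute)

lemma cdot_self_eq_0 [simp]: "cdot x x = 0 \<longleftrightarrow> x = 0"
  by (simp only: cdot_self of_real_eq_0_iff)
    (simp add: sum_nonneg_eq_0_iff vec_eq_iff)

lemma cdot_adjoint: "cdot x (A *v y) = cdot (conj_transpose A *v x) y"
  unfolding cdot_def matrix_vector_mult_def conj_transpose_def
  by (simp add: sum_distrib_left sum_distrib_right) (subst sum.swap, simp add: mult_ac)

lemma hermitian_cdot: "hermitian A \<Longrightarrow> cdot (A *v x) y = cdot x (A *v y)"
  by (simp add: hermitian_def cdot_adjoint)

lemma cdot_Jmat: "cdot (Jmat *v x) y = - cdot x (Jmat *v y)"
  by (simp add: cdot_adjoint conj_transpose_Jmat matrix_vector_mult_minus_left)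

text \<open>Along the line \<open>x - t y\<close> with \<open>y = A *v x\<close> the quadratic form
  is \<open>- 2 t a + t^2 b\<close>, where \<open>a\<close> is the squared norm of \<open>y\<close>.
  If \<open>y\<close> were nonzero, the linear term would make it negative for small positive
  \<open>t\<close>.\<close>

lemma pos_semidef_kernel:
  assumes A: "pos_semidef A" and x: "cdot x (A *v x) = 0"
  shows "A *v x = 0"
proof (rule ccontr)
  assume n: "A *v x \<noteq> 0"
  define y where "y = A *v x"
  have h: "hermitian A" and p: "\<And>x. 0 \<le> cdot x (A *v x)" using A by (auto simp: pos_semidef_def)
  have xy: "cdot x y = 0" using x by (simp add: y_def)
  define a where "a = Re (cdot y y)"
  define b where "b = Re (cdot y (A *v y))"
  have yy: "cdot y y = of_real a" and a: "a > 0"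
  proof -
    show yy: "cdot y y = of_real a" by (simp add: a_def cdot_self)
    have "a \<ge> 0" by (simp add: a_def cdot_self sum_nonneg)
    moreover have "a \<noteq> 0" using yy n by (auto simp: y_def)
    ultimately show "a > 0" by simp
  qed
  have b: "b \<ge> 0" using p[of y] by (simp add: b_def less_eq_complex_def)
  have q: "0 \<le> - 2 * t * a + t\<^sup>2 * b" for t :: real
  proof -
    have "cdot x (A *v y) = cdot y y" using hermitian_cdot[OF h, of x y] by (simp add: y_def)
    then have "cdot (x - of_real t *s y) (A *v (x - of_real t *s y))
        = - 2 * t * cdot y y + t\<^sup>2 * cdot y (A *v y)"
      by (simp add: matrix_vector_mult_diff_distrib vector_scalar_commute cdot_diff_left cdot_diff_right
          cdot_scale_left cdot_scale_right xy y_def [symmetric] power2_eq_square algebra_simps)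
    then show ?thesis
      using p[of "x - of_real t *s y"] by (simp add: less_eq_complex_def yy b_def flip: of_real_power)
  qed
  \<comment> \<open>Then \<open>t * b \<le> a\<close>, so the form is at most
    \<open>- t * a\<close>; the \<open>+ 1\<close> keeps the denominator positive when
    \<open>b = 0\<close>.\<close>
  define t where "t = a / (b + 1)"
  have "t > 0" using a b by (simp add: t_def)
  have "t * b \<le> a" using a b by (simp add: t_def field_simps)
  have "- 2 * t * a + t\<^sup>2 * b = t * (t * b - 2 * a)" by (simp add: power2_eq_square algebra_simps)
  also have "\<dots> < 0" using \<open>t > 0\<close> \<open>t * b \<le> a\<close> a by (simp add: mult_pos_neg)
  finally show False using q[of t] by simp
qed

text \<open>Stacking \<open>\<alpha>\<close> on \<open>\<alpha> ** Jmat\<close> gives a square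
  matrix \<open>U\<close> with orthonormal rows, hence a unitary one. In
  \<open>x = conj_transpose U *v (U *v x)\<close> the upper half of \<open>U *v x\<close> is
  \<open>\<alpha> *v x\<close>, so only the lower half contributes. This makes every admissible
  initial value a combination of the columns of the initial matrix in the weak Atkinson
  condition.\<close>

lemma Gam_kernel_Lagrangian:
  fixes \<alpha> :: "complex ^ ('n::finite + 'n) ^ 'n"
  assumes \<alpha>: "\<alpha> \<in> Gam" and x: "\<alpha> *v x = 0"
  shows "x = - (Jmat ** conj_transpose \<alpha>) *v (\<alpha> *v (Jmat *v x))"
proof -
  define U :: "complex ^ ('n + 'n) ^ ('n + 'n)" where
    "U = (\<chi> i. case i of Inl a \<Rightarrow> \<alpha> $ a | Inr a \<Rightarrow> (\<alpha> ** Jmat) $ a)"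
  have U: "(U ** conj_transpose U) $ i $ j = (case i of
      Inl a \<Rightarrow> (case j of Inl b \<Rightarrow> (\<alpha> ** conj_transpose \<alpha>) $ a $ b
                       | Inr b \<Rightarrow> (\<alpha> ** conj_transpose (\<alpha> ** Jmat)) $ a $ b)
    | Inr a \<Rightarrow> (case j of Inl b \<Rightarrow> (\<alpha> ** Jmat ** conj_transpose \<alpha>) $ a $ b
                       | Inr b \<Rightarrow> (\<alpha> ** Jmat ** conj_transpose (\<alpha> ** Jmat)) $ a $ b))" for i j
    by (simp add: U_def matrix_matrix_mult_def conj_transpose_def split: sum.splits)
  have m: "A ** (- B) = - (A ** B)" "(- A) ** C = - (A ** C)"
    for A :: "complex ^ 'x ^ 'y" and B C :: "complex ^ 'z ^ 'x"
    by (simp_all add: matrix_matrix_mult_def vec_eq_iff sum_negf)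
  have J: "conj_transpose (\<alpha> ** Jmat) = - (Jmat ** conj_transpose \<alpha>)"
    by (simp add: conj_transpose_mult conj_transpose_Jmat m)
  have JJ: "(Jmat :: complex ^ ('n + 'n) ^ ('n + 'n)) ** Jmat = - mat 1"
    by (simp add: matrix_eq matrix_vector_mul_assoc [symmetric] matrix_vector_mult_minus_left)
  have "\<alpha> ** Jmat ** (Jmat ** conj_transpose \<alpha>) = \<alpha> ** (Jmat ** Jmat) ** conj_transpose \<alpha>"
    by (simp only: matrix_mul_assoc)
  also have "\<dots> = - mat 1"
    using \<alpha> by (simp add: JJ m Gam_def)
  finally have "U ** conj_transpose U = mat 1"
    using \<alpha> by (auto simp: vec_eq_iff U J m Gam_def matrix_mul_assoc mat_def split: sum.splits)
  then have "conj_transpose U ** U = mat 1"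
    by (simp add: matrix_left_right_inverse)
  then have "x = conj_transpose U *v (U *v x)"
    by (simp add: matrix_vector_mul_assoc)
  also have "\<dots> = conj_transpose (\<alpha> ** Jmat) *v (\<alpha> *v (Jmat *v x))"
  proof -
    have "U *v x = (\<chi> i. case i of Inl a \<Rightarrow> 0 | Inr a \<Rightarrow> ((\<alpha> ** Jmat) *v x) $ a)"
      using x by (auto simp: U_def vec_eq_iff matrix_vector_mult_def split: sum.splits)
    moreover have "conj_transpose U *v (\<chi> i. case i of Inl a \<Rightarrow> 0 | Inr a \<Rightarrow> w $ a) = conj_transpose (\<alpha> ** Jmat) *v w"
      for w
      by (simp add: vec_eq_iff matrix_vector_mult_def conj_transpose_def sum_UNIV_sum_type)
        (simp add: U_def)
    ultimately show ?thesis
      by (simp add: matrix_vector_mul_assoc)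
  qed
  finally show ?thesis by (simp add: J)
qed

text \<open>Moving the factors in the preceding representation of \<open>x\<close> across the inner
  product leaves \<open>\<alpha> *v y\<close>. This removes the boundary terms from the Lagrange
  identity.\<close>

lemma Gam_isotropic:
  assumes \<alpha>: "\<alpha> \<in> Gam" and x: "\<alpha> *v x = 0" and y: "\<alpha> *v y = 0"
  shows "cdot x (Jmat *v y) = 0"
proof -
  obtain u where "x = - (Jmat ** conj_transpose \<alpha>) *v u"
    using Gam_kernel_Lagrangian[OF \<alpha> x] by blast
  then have "x = Jmat *v (conj_transpose \<alpha> *v (- u))"
    by (simp add: matrix_vector_mul_assoc matrix_vector_mult_minus_left)
      (metis diff_0 matrix_vector_mult_0_right matrix_vector_mult_diff_distrib)
  then show ?thesis
    using y by (simp add: cdot_Jmat) (metis cdot_adjoint cdot_zero_right conj_transpose_conj_transpose)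
qed

section \<open>Rank and dimension\<close>

text \<open>Conjugation is not linear, but it sends a linear combination to one with conjugated
  coefficients, so a conjugated basis still spans. Since conjugation is an involution, the
  inequality can be used in both directions.\<close>

lemma vec_dim_cnj_image_le:
  fixes S :: "(complex ^ 'd) set"
  shows "vec.dim ((\<lambda>v. \<chi> i. cnj (v $ i)) ` S) \<le> vec.dim S"
proof -
  let ?c = "\<lambda>v :: complex ^ 'd. \<chi> i. cnj (v $ i)"
  obtain B where B: "B \<subseteq> S" "vec.independent B" "S \<subseteq> vec.span B" "card B = vec.dim S"
    by (rule vec.basis_exists)
  have "?c x \<in> vec.span (?c ` B)" if "x \<in> vec.span B" for x
    using that
  proof (induction rule: vec.span_induct_alt)
    case base
    have "?c 0 = 0" by (simp add: vec_eq_iff)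
    then show ?case by (metis vec.span_zero)
  next
    case (step c x y)
    have "?c (c *s x + y) = cnj c *s ?c x + ?c y" by (simp add: vec_eq_iff)
    with step show ?case by (simp add: vec.span_add vec.span_scale vec.span_base)
  qed
  then have "vec.dim (?c ` S) \<le> card (?c ` B)"
    using B by (intro vec.dim_le_card) (auto simp: vec.finiteI_independent)
  also have "\<dots> \<le> card B"
    using B by (intro card_image_le) (simp add: vec.finiteI_independent)
  finally show ?thesis using B by simp
qed

lemma range_matrix_eq_span_columns: "range ((*v) A) = vec.span (columns A)"
  for A :: "'a::field ^ 'n ^ 'm"
proof
  show "range ((*v) A) \<subseteq> vec.span (columns A)"
    using matrix_vector_mult_in_columnspace_gen by auto
  have "column j A = A *v axis j 1" for j
    by (simp add: column_def matrix_vector_mult_def axis_def vec_eq_iff if_distrib cong: if_cong)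
  then have "columns A \<subseteq> range ((*v) A)" by (auto simp: columns_def)
  moreover have "vec.subspace (range ((*v) A))"
    using vec.linear_subspace_image[OF matrix_vector_mul_linear_gen vec.subspace_UNIV] .
  ultimately show "vec.span (columns A) \<subseteq> range ((*v) A)"
    by (rule vec.span_minimal)
qed

text \<open>\<open>rank\<close> is the dimension of the row space, whereas the range is spanned by
  the columns. For a Hermitian matrix the two sets are conjugates of each other.\<close>

lemma hermitian_rank: "hermitian A \<Longrightarrow> rank A = vec.dim (range ((*v) A))"
proof -
  let ?c = "\<lambda>v :: complex ^ 'a. \<chi> i. cnj (v $ i)"
  assume "hermitian A"
  then have A: "cnj (A $ i $ j) = A $ j $ i" for i j
    by (metis (no_types, lifting) conj_transpose_def hermitian_def vec_lambda_beta)
  have "column i A = ?c (row i A)" for i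
    by (simp add: column_def row_def A)
  then have 1: "columns A = ?c ` rows A" by (auto simp: columns_def rows_def)
  have "?c (?c v) = v" for v by (simp add: vec_eq_iff)
  then have 2: "rows A = ?c ` columns A" by (force simp: 1 image_image)
  show ?thesis
    unfolding row_rank_def_gen range_matrix_eq_span_columns vec.dim_span
    using vec_dim_cnj_image_le[of "rows A"] vec_dim_cnj_image_le[of "columns A"]
    by (simp flip: 1 2)
qed

text \<open>The range of \<open>A\<close> and its image under \<^const>\<open>Jmat\<close> meet trivially.\<close>

lemma hermitian_rank_le_half:
  fixes A :: "complex ^ ('n::finite + 'n) ^ ('n + 'n)"
  assumes h: "hermitian A" and 0: "\<And>x. A *v (Jmat *v (A *v x)) = 0"
  shows "rank A \<le> CARD('n)"
proof -
  let ?W = "range ((*v) A)" and ?W' = "(*v) Jmat ` range ((*v) A)"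
  have J: "Vector_Spaces.linear (*s) (*s) ((*v) Jmat :: complex ^ ('n + 'n) \<Rightarrow> _)"
    by (rule matrix_vector_mul_linear_gen)
  have W: "vec.subspace ?W"
    using vec.linear_subspace_image[OF matrix_vector_mul_linear_gen vec.subspace_UNIV] .
  have W': "vec.subspace ?W'"
    using vec.linear_subspace_image[OF J W] .
  have "inj ((*v) Jmat :: complex ^ ('n + 'n) \<Rightarrow> _)"
    by (metis Jmat_Jmat_vec injI neg_equal_iff_equal)
  then have d: "vec.dim ?W' = vec.dim ?W"
    by (intro vec.dim_image_eq[OF J]) (simp add: inj_on_def)
  have "w = 0" if "w = A *v x" "w = Jmat *v (A *v y)" for w x y
  proof -
    have "cdot w w = cdot x (A *v (Jmat *v (A *v y)))"
      using that hermitian_cdot[OF h] by metis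
    then show ?thesis by (simp add: 0)
  qed
  then have "?W \<inter> ?W' \<subseteq> {0}" by blast
  then have "vec.dim (?W \<inter> ?W') = 0" by (simp only: vec.dim_eq_0)
  then have "vec.dim {x + y |x y. x \<in> ?W \<and> y \<in> ?W'} = 2 * vec.dim ?W"
    using vec.dim_sums_Int[OF W W'] d by linarith
  moreover have "vec.dim {x + y |x y. x \<in> ?W \<and> y \<in> ?W'} \<le> CARD('n + 'n)"
    by (rule vec.dim_subset_UNIV [unfolded vec.dimension_def card_cart_basis])
  ultimately have "2 * vec.dim ?W \<le> CARD('n + 'n)" by linarith
  then show ?thesis by (simp add: hermitian_rank[OF h])
qed

section \<open>Spanning sets and bounds for independent sequences\<close>

definition seq_single :: "nat \<Rightarrow> complex ^ 'd \<Rightarrow> nat \<Rightarrow> complex ^ 'd" where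
  "seq_single k v = (\<lambda>i. if i = k then v else 0)"

lemma seq_in_span:
  assumes K: "finite K" and in_K: "\<And>k. k \<in> K \<Longrightarrow> z k \<in> vec.span (B k)"
    and off_K: "\<And>k. k \<notin> K \<Longrightarrow> z k = 0"
  shows "z \<in> cseq.span (\<Union>k\<in>K. seq_single k ` B k)"
proof -
  have s: "seq_single k v \<in> cseq.span (seq_single k ` A)" if "v \<in> vec.span A" for k v and A :: "(complex ^ 'a) set"
    using that
  proof (induction rule: vec.span_induct_alt)
    case base
    have "seq_single k 0 = (0 :: nat \<Rightarrow> complex ^ 'a)" by (simp add: seq_single_def fun_eq_iff)
    then show ?case by (metis cseq.span_zero)
  next
    case (step c x y)
    have "seq_single k (c *s x + y) = seq_scale c (seq_single k x) + seq_single k y"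
      by (simp add: seq_single_def seq_scale_def fun_eq_iff)
    moreover have "seq_scale c (seq_single k x) + seq_single k y \<in> cseq.span (seq_single k ` A)"
      using step by (intro cseq.span_add cseq.span_scale) (auto intro: cseq.span_base)
    ultimately show ?case by (simp only:)
  qed
  have "(\<Sum>k\<in>K. seq_single k (z k)) \<in> cseq.span (\<Union>k\<in>K. seq_single k ` B k)"
  proof (rule cseq.span_sum)
    fix k assume "k \<in> K"
    then show "seq_single k (z k) \<in> cseq.span (\<Union>k\<in>K. seq_single k ` B k)"
      using s[OF in_K[OF \<open>k \<in> K\<close>]] cseq.span_mono[of "seq_single k ` B k" "\<Union>k\<in>K. seq_single k ` B k"] by blast
  qed
  moreover have "(\<Sum>k\<in>K. seq_single k (z k)) = z"
  proof
    fix i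
    have "(\<Sum>k\<in>K. seq_single k (z k)) i = (\<Sum>k\<in>K. seq_single k (z k) i)"
      by (induction K rule: infinite_finite_induct) auto
    also have "\<dots> = z i"
      using K off_K by (simp add: seq_single_def)
    finally show "(\<Sum>k\<in>K. seq_single k (z k)) i = z i" .
  qed
  ultimately show ?thesis by simp
qed

text \<open>All members of \<open>X\<close> are combinations of sequences supported at a single
  index \<open>k\<close> with value in \<open>B k\<close>, and there are at most as many of these as
  the sum counts. With a basis of the whole space at each index this yields the crude bound on
  \<open>r\<close>, with bases of the ranges of \<open>\<Psi> k\<close> the rank bound.\<close>

lemma independent_seqs_card_le:
  fixes X :: "(nat \<Rightarrow> complex ^ 'd) set"
  assumes "finite K" and "\<And>k. k \<in> K \<Longrightarrow> finite (B k)" and "cseq.independent X"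
    and "\<And>z k. z \<in> X \<Longrightarrow> k \<in> K \<Longrightarrow> z k \<in> vec.span (B k)"
    and "\<And>z k. z \<in> X \<Longrightarrow> k \<notin> K \<Longrightarrow> z k = 0"
  shows "finite X \<and> card X \<le> (\<Sum>k\<in>K. card (B k))"
proof -
  let ?T = "\<Union>k\<in>K. seq_single k ` B k"
  have "finite X \<and> card X \<le> card ?T"
  proof (rule cseq.independent_span_bound)
    show "finite ?T" using assms by simp
    show "X \<subseteq> cseq.span ?T" using assms seq_in_span[of K _ B] by blast
  qed fact
  moreover have "card ?T \<le> (\<Sum>k\<in>K. card (seq_single k ` B k))"
    using assms by (intro card_UN_le)
  moreover have "\<dots> \<le> (\<Sum>k\<in>K. card (B k))"
    using assms by (intro sum_mono card_image_le)
  ultimately show ?thesis by linarith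
qed

section \<open>Pointwise sums and sesquilinearity of the semi-inner product\<close>

lemma sum_seq_apply: "(\<Sum>x\<in>A. f x) k = (\<Sum>x\<in>A. f x k)" for f :: "'a \<Rightarrow> nat \<Rightarrow> complex ^ 'd"
  by (induction A rule: infinite_finite_induct) auto

lemma cdot_sum_right: "cdot x (\<Sum>i\<in>A. f i) = (\<Sum>i\<in>A. cdot x (f i))"
  by (induction A rule: infinite_finite_induct) (auto simp: cdot_add_right)

lemma semi_inner_add_right: "semi_inner P N z (u + v) = semi_inner P N z u + semi_inner P N z v"
  by (simp add: semi_inner_def matrix_vector_right_distrib cdot_add_right sum.distrib)

lemma semi_inner_diff_right: "semi_inner P N z (u - v) = semi_inner P N z u - semi_inner P N z v"
  by (simp add: semi_inner_def matrix_vector_mult_diff_distrib cdot_diff_right sum_subtractf)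

lemma semi_inner_add_left: "semi_inner P N (z + u) v = semi_inner P N z v + semi_inner P N u v"
  by (simp add: semi_inner_def cdot_add_left sum.distrib)

lemma semi_inner_scale_right: "semi_inner P N z (seq_scale c u) = c * semi_inner P N z u"
  by (simp add: semi_inner_def seq_scale_def vector_scalar_commute cdot_scale_right sum_distrib_left)

lemma semi_inner_scale_left: "semi_inner P N (seq_scale c z) u = cnj c * semi_inner P N z u"
  by (simp add: semi_inner_def seq_scale_def cdot_scale_left sum_distrib_left)

lemma semi_inner_sum_right: "semi_inner P N z (\<Sum>i\<in>A. f i) = (\<Sum>i\<in>A. semi_inner P N z (f i))"
proof (induction A rule: infinite_finite_induct)
  case (insert x F)
  then show ?case by (metis semi_inner_add_right sum.insert)
qed (simp_all add: semi_inner_def)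

text \<open>Here \<open>p\<close> is a polynomial with \<open>p(R) v = 0\<close>. Splitting off a
  complex root \<open>\<mu>\<close> leaves a cofactor annihilating \<open>w = R v - \<mu> v\<close>,
  so by induction some power of \<open>R\<close> kills \<open>w\<close>. That power maps
  \<open>v\<close> into the kernel of \<open>R - \<mu>\<close>, which is harmless for
  \<open>\<mu> = 0\<close> and excluded otherwise unless the image is zero. Summing up to
  \<open>n\<close> instead of \<open>degree p\<close> allows vanishing top coefficients.\<close>

lemma nilpotent_if_no_nonzero_eigenvalue:
  fixes R :: "(nat \<Rightarrow> complex ^ 'd) \<Rightarrow> nat \<Rightarrow> complex ^ 'd"
  assumes add: "\<And>x y. R (x + y) = R x + R y"
    and scale: "\<And>c x. R (seq_scale c x) = seq_scale c (R x)"
    and invariant: "\<And>\<mu> x. P x \<Longrightarrow> P (R x - seq_scale \<mu> x)"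
    and eigen: "\<And>\<mu> x. \<mu> \<noteq> 0 \<Longrightarrow> P x \<Longrightarrow> R x = seq_scale \<mu> x \<Longrightarrow> x = 0"
    and "P v" "p \<noteq> 0" "degree p \<le> n" "(\<Sum>i\<le>n. seq_scale (coeff p i) ((R ^^ i) v)) = 0"
  shows "\<exists>m. (R ^^ m) v = 0"
  using assms(5-)
proof (induction n arbitrary: p v)
  case 0
  then have "coeff p 0 \<noteq> 0" by (metis le_zero_eq leading_coeff_0_iff)
  moreover have "seq_scale (coeff p 0) v = 0" using 0(4) by (simp add: zero_fun_def)
  ultimately have "v = 0" by (metis cseq.scale_eq_0_iff)
  then show ?case by (intro exI[of _ 0]) simp
next
  case (Suc n)
  have R_diff: "R (x - seq_scale \<mu> y) = R x - seq_scale \<mu> (R y)" for x y \<mu>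
    using add[of "x - seq_scale \<mu> y" "seq_scale \<mu> y"] by (simp add: scale eq_diff_eq)
  have pow_add: "(R ^^ i) (x - seq_scale \<mu> y) = (R ^^ i) x - seq_scale \<mu> ((R ^^ i) y)" for i x y \<mu>
    by (induction i) (simp_all only: R_diff funpow.simps comp_apply id_apply)
  show ?case
  proof (cases "degree p = 0")
    case True
    then have "coeff p (Suc i) = 0" for i by (simp add: coeff_eq_0)
    then have "seq_scale (coeff p 0) v = 0"
      using Suc.prems(4) by (simp only: sum.atMost_Suc_shift) (simp add: zero_fun_def)
    moreover have "coeff p 0 \<noteq> 0" using True Suc.prems(2) by (metis leading_coeff_0_iff)
    ultimately have "v = 0" by (metis cseq.scale_eq_0_iff)
    then show ?thesis by (intro exI[of _ 0]) simp
  next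
    case False
    then obtain \<mu> where "poly p \<mu> = 0"
      using fundamental_theorem_of_algebra [of p] constant_degree [of p] by auto
    then obtain q where q: "p = [:- \<mu>, 1:] * q" by (auto simp: poly_eq_0_iff_dvd)
    with Suc.prems(2) have "q \<noteq> 0" by auto
    then have "degree p = Suc (degree q)" by (simp add: q degree_mult_eq del: mult_pCons_left)
    with Suc.prems(3) have dq: "degree q \<le> n" by simp
    have c0: "coeff p 0 = - \<mu> * coeff q 0" by (simp add: q)
    have cS: "coeff p (Suc i) = coeff q i - \<mu> * coeff q (Suc i)" for i by (simp add: q)
    \<comment> \<open>This allows a zero term to be appended, so that both sums below run up to
      \<open>Suc n\<close> after the index shift.\<close>
    have qn: "coeff q (Suc n) = 0" using dq by (simp add: coeff_eq_0)
    define w where "w = R v - seq_scale \<mu> v"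
    let ?r = "\<lambda>i. (R ^^ i) v"
    have "(\<Sum>i\<le>n. seq_scale (coeff q i) ((R ^^ i) w))
        = (\<Sum>i\<le>n. seq_scale (coeff q i) (?r (Suc i))) - (\<Sum>i\<le>n. seq_scale (\<mu> * coeff q i) (?r i))"
      by (simp add: w_def pow_add cseq.scale_right_diff_distrib sum_subtractf mult.commute
          funpow_swap1 flip: sum_subtractf)
    also have "(\<Sum>i\<le>n. seq_scale (\<mu> * coeff q i) (?r i)) = (\<Sum>i\<le>Suc n. seq_scale (\<mu> * coeff q i) (?r i))"
      by (simp only: sum.atMost_Suc qn) simp
    also have "(\<Sum>i\<le>n. seq_scale (coeff q i) (?r (Suc i))) - (\<Sum>i\<le>Suc n. seq_scale (\<mu> * coeff q i) (?r i))
        = (\<Sum>i\<le>Suc n. seq_scale (coeff p i) (?r i))"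
      by (simp only: sum.atMost_Suc_shift c0 cS cseq.scale_left_diff_distrib sum_subtractf
          mult_minus_left cseq.scale_minus_left) simp
    also have "\<dots> = 0" by fact
    finally have "\<exists>m. (R ^^ m) w = 0"
      using Suc.IH[OF invariant[OF Suc.prems(1), of \<mu>] \<open>q \<noteq> 0\<close> dq] unfolding w_def by blast
    then obtain m where m: "(R ^^ m) w = 0" ..
    have P_pow: "P ((R ^^ i) v)" for i
    proof (induction i)
      case (Suc i)
      then show ?case using invariant[of "(R ^^ i) v" 0] by simp
    qed (use Suc.prems in simp)
    from m have Rm: "R ((R ^^ m) v) = seq_scale \<mu> ((R ^^ m) v)"
      by (simp only: w_def pow_add funpow_swap1 right_minus_eq)
    show ?thesis
    proof (cases "\<mu> = 0")
      case True
      with Rm have "(R ^^ Suc m) v = 0" by simp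
      then show ?thesis by blast
    next
      case False
      then show ?thesis using eigen[OF False P_pow Rm] by blast
    qed
  qed
qed

text \<open>Independence concerns sets, while iterates of an operator may repeat. Distinct members
  are too many to be independent; if two coincide, their difference is already a nontrivial
  relation.\<close>

lemma dependent_family:
  fixes f :: "nat \<Rightarrow> nat \<Rightarrow> complex ^ 'd"
  assumes "\<And>X. X \<subseteq> range f \<Longrightarrow> cseq.independent X \<Longrightarrow> card X \<le> D"
  obtains c where "\<exists>i\<le>D. c i \<noteq> 0" "(\<Sum>i\<le>D. seq_scale (c i) (f i)) = 0"
proof (cases "inj_on f {..D}")
  case True
  then have "card (f ` {..D}) = Suc D" by (simp add: card_image)
  then have "cseq.dependent (f ` {..D})"
    using assms[of "f ` {..D}"] by fastforce
  then obtain u where u: "\<exists>v\<in>f ` {..D}. u v \<noteq> 0" "(\<Sum>v\<in>f ` {..D}. seq_scale (u v) v) = 0"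
    by (auto simp: cseq.dependent_finite)
  show ?thesis
    using that[of "u \<circ> f"] u True by (auto simp: sum.reindex)
next
  case False
  then obtain i j where ij: "i \<le> D" "j \<le> D" "i \<noteq> j" "f i = f j" by (auto simp: inj_on_def)
  let ?c = "\<lambda>k. (if k = i then 1 else 0) - (if k = j then 1 else 0) :: complex"
  have "(\<Sum>k\<le>D. seq_scale (?c k) (f k)) = (\<Sum>k\<le>D. if k = i then f k else 0) - (\<Sum>k\<le>D. if k = j then f k else 0)"
    unfolding sum_subtractf [symmetric] by (intro sum.cong) (auto simp: cseq.scale_left_diff_distrib)
  also have "\<dots> = 0" using ij by simp
  finally have "(\<Sum>k\<le>D. seq_scale (?c k) (f k)) = 0" .
  moreover have "\<exists>k\<le>D. ?c k \<noteq> 0" using ij by (intro exI[of _ i]) simp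
  ultimately show ?thesis using that[of ?c] by blast
qed

section \<open>The boundary value problem\<close>

locale symplectic_bvp =
  fixes S V :: "nat \<Rightarrow> complex ^ ('n::finite + 'n) ^ ('n + 'n)"
    and \<alpha> \<beta> :: "complex ^ ('n + 'n) ^ 'n"
    and N :: nat
  assumes \<alpha>: "\<alpha> \<in> Gam" and \<beta>: "\<beta> \<in> Gam"
    and S_symplectic: "\<And>k. k \<in> {0..N} \<Longrightarrow> conj_transpose (S k) ** Jmat ** S k = Jmat"
    and VJS_hermitian: "\<And>k. k \<in> {0..N} \<Longrightarrow> hermitian (conj_transpose (V k) ** Jmat ** S k)"
    and VJV_zero: "\<And>k. k \<in> {0..N} \<Longrightarrow> conj_transpose (V k) ** Jmat ** V k = 0"
    and Psi_psd: "\<And>k. k \<in> {0..N} \<Longrightarrow> pos_semidef (Psi S V k)"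
begin

abbreviation \<Psi> where "\<Psi> \<equiv> Psi S V"
abbreviation ip where "ip \<equiv> semi_inner (Psi S V) N"
abbreviation eigfuns where "eigfuns \<equiv> eigenfunctions S V N \<alpha> \<beta>"

text \<open>This is the linear relation between solutions and right-hand sides. Vanishing beyond
  \<open>N + 1\<close> is demanded of \<open>z\<close> only, so that equality of solutions is
  equality of finite sequences.\<close>

definition solution :: "(nat \<Rightarrow> complex ^ ('n + 'n)) \<Rightarrow> (nat \<Rightarrow> complex ^ ('n + 'n)) \<Rightarrow> bool" where
  "solution z f \<longleftrightarrow> solves_bvp S V N \<alpha> \<beta> f z \<and> (\<forall>k>N + 1. z k = 0)"

section \<open>Algebraic identities for the coefficient matrices\<close>

lemma S_J_S: "k \<le> N \<Longrightarrow> conj_transpose (S k) *v (Jmat *v (S k *v x)) = Jmat *v x"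
  using S_symplectic[of k] by (simp add: matrix_vector_mul_assoc matrix_mul_assoc)

lemma V_J_V: "k \<le> N \<Longrightarrow> conj_transpose (V k) *v (Jmat *v (V k *v x)) = 0"
  using VJV_zero[of k] by (simp add: matrix_vector_mul_assoc matrix_mul_assoc)

text \<open>The symplectic identity exhibits a left inverse of \<open>S k\<close>, which for a
  square matrix is also a right inverse; hence the adjoint of \<open>S k\<close> is symplectic as
  well.\<close>

lemma S_J_adjoint_S:
  assumes k: "k \<le> N"
  shows "S k *v (Jmat *v (conj_transpose (S k) *v x)) = Jmat *v x"
proof -
  have "- Jmat ** conj_transpose (S k) ** Jmat ** S k = mat 1"
    using k by (simp add: matrix_eq matrix_vector_mul_assoc [symmetric] S_J_S
        matrix_vector_mult_minus_left)
  then have "S k ** (- Jmat ** conj_transpose (S k) ** Jmat) = mat 1"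
    by (simp add: matrix_left_right_inverse [of "S k"])
  then have *: "S k *v (Jmat *v (conj_transpose (S k) *v (Jmat *v y))) = - y" for y
    by (simp add: matrix_eq matrix_vector_mul_assoc [symmetric] matrix_vector_mult_minus_left
        matrix_vector_mult_minus_right) (metis minus_equation_iff)
  show ?thesis using *[of "Jmat *v x"] by (simp add: matrix_vector_mult_minus_right)
qed

lemma VJS_swap:
  assumes k: "k \<le> N"
  shows "conj_transpose (V k) *v (Jmat *v (S k *v x)) = - (conj_transpose (S k) *v (Jmat *v (V k *v x)))"
proof -
  have "conj_transpose (V k) ** Jmat ** S k = conj_transpose (conj_transpose (V k) ** Jmat ** S k)"
    using VJS_hermitian[of k] k by (simp add: hermitian_def)
  also have "\<dots> = conj_transpose (S k) ** (- Jmat ** V k)"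
    by (simp add: conj_transpose_mult conj_transpose_Jmat)
  finally have "(conj_transpose (V k) ** Jmat ** S k) *v x = (conj_transpose (S k) ** (- Jmat ** V k)) *v x"
    by simp
  then show ?thesis
    by (simp add: matrix_vector_mul_assoc [symmetric] matrix_vector_mult_minus_left matrix_vector_mult_minus_right)
qed

text \<open>Rewriting \<open>Jmat *v x\<close> as \<open>S k *v ?y\<close> by
  \<open>S_J_adjoint_S\<close> brings the Hermitian condition into play. The result supplies the
  second form \<open>Psi_vec'\<close> of \<open>\<Psi> k\<close>, with \<open>V k\<close> on the
  left.\<close>

lemma S_J_adjoint_V:
  assumes k: "k \<le> N"
  shows "S k *v (Jmat *v (conj_transpose (V k) *v x)) = - (V k *v (Jmat *v (conj_transpose (S k) *v x)))"
proof -
  let ?y = "Jmat *v (conj_transpose (S k) *v x)"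
  have "conj_transpose (V k) *v x = - (conj_transpose (V k) *v (Jmat *v (S k *v ?y)))"
    using k by (simp add: S_J_adjoint_S matrix_vector_mult_minus_right)
  also have "\<dots> = conj_transpose (S k) *v (Jmat *v (V k *v ?y))"
    using k by (simp add: VJS_swap)
  finally show ?thesis using k by (simp add: S_J_adjoint_S)
qed

lemma Psi_vec: "\<Psi> k *v x = Jmat *v (S k *v (Jmat *v (conj_transpose (V k) *v (Jmat *v x))))"
  by (simp add: Psi_def matrix_vector_mul_assoc matrix_mul_assoc)

lemma Psi_vec': "k \<le> N \<Longrightarrow> \<Psi> k *v x = - (Jmat *v (V k *v (Jmat *v (conj_transpose (S k) *v (Jmat *v x)))))"
  by (simp add: Psi_vec S_J_adjoint_V matrix_vector_mult_minus_right)

lemma Psi_S: "k \<le> N \<Longrightarrow> \<Psi> k *v (S k *v x) = Jmat *v (V k *v x)"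
  by (simp add: Psi_vec' S_J_S matrix_vector_mult_minus_right)

text \<open>Expanding the left factor by \<open>Psi_vec\<close> and the right one by
  \<open>Psi_vec'\<close> leaves the vanishing product of \<open>V_J_V\<close> in the
  middle.\<close>

lemma Psi_J_Psi: "k \<le> N \<Longrightarrow> \<Psi> k *v (Jmat *v (\<Psi> k *v x)) = 0"
  by (subst Psi_vec, subst Psi_vec') (simp_all add: V_J_V matrix_vector_mult_minus_right)

lemma Psi_V: "k \<le> N \<Longrightarrow> \<Psi> k *v (V k *v x) = 0"
  using Psi_J_Psi[of k "S k *v x"] by (simp add: Psi_S matrix_vector_mult_minus_right)

lemma Psi_cdot: "k \<le> N \<Longrightarrow> cdot (\<Psi> k *v x) y = cdot x (\<Psi> k *v y)"
  using Psi_psd[of k] by (simp add: pos_semidef_def hermitian_cdot)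

lemma Psi_zero: "k \<le> N \<Longrightarrow> cdot x (\<Psi> k *v x) = 0 \<Longrightarrow> \<Psi> k *v x = 0"
  using Psi_psd[of k] by (simp add: pos_semidef_kernel)

lemma rank_Psi_le: "k \<le> N \<Longrightarrow> rank (\<Psi> k) \<le> CARD('n)"
  using Psi_psd[of k] by (intro hermitian_rank_le_half) (auto simp: pos_semidef_def Psi_J_Psi)

text \<open>The left equation is implicit, since \<open>z\<close> also occurs on its right-hand
  side. Applying \<open>\<Psi> k\<close> removes the inhomogeneity by \<open>Psi_J_Psi\<close> and
  gives \<open>\<Psi> k *v z = Jmat *v (V k *v z')\<close>, which turns it into an explicit backward
  step.\<close>

lemma step_iff:
  assumes k: "k \<le> N"
  shows "Jmat *v (z - S k *v z') = \<Psi> k *v (l *s z + g) \<longleftrightarrow>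
    z = (S k + scale_mat l (V k)) *v z' - Jmat *v (\<Psi> k *v g)"
proof
  assume "Jmat *v (z - S k *v z') = \<Psi> k *v (l *s z + g)"
  then have "z - S k *v z' = - (Jmat *v (\<Psi> k *v (l *s z + g)))" by (simp add: Jmat_eq_iff)
  then have z: "z = S k *v z' - Jmat *v (\<Psi> k *v (l *s z + g))" by (simp add: algebra_simps)
  then have "\<Psi> k *v z = \<Psi> k *v (S k *v z')"
    using k by (metis Psi_J_Psi diff_zero matrix_vector_mult_diff_distrib)
  then have "\<Psi> k *v z = Jmat *v (V k *v z')"
    using k by (simp add: Psi_S)
  with z show "z = (S k + scale_mat l (V k)) *v z' - Jmat *v (\<Psi> k *v g)"
    by (simp add: matrix_vector_right_distrib vector_scalar_commute matrix_vector_mult_add_rdistrib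
        scale_mat_vec algebra_simps)
next
  assume z: "z = (S k + scale_mat l (V k)) *v z' - Jmat *v (\<Psi> k *v g)"
  then have P: "\<Psi> k *v z = Jmat *v (V k *v z')"
    using k by (simp add: matrix_vector_mult_add_rdistrib matrix_vector_right_distrib
        matrix_vector_mult_diff_distrib scale_mat_vec vector_scalar_commute Psi_S Psi_V Psi_J_Psi)
  have "z - S k *v z' = l *s (V k *v z') - Jmat *v (\<Psi> k *v g)"
    by (subst z) (simp add: matrix_vector_mult_add_rdistrib scale_mat_vec)
  then show "Jmat *v (z - S k *v z') = \<Psi> k *v (l *s z + g)"
    by (simp add: matrix_vector_mult_diff_distrib matrix_vector_right_distrib vector_scalar_commute P)
qed

text \<open>Each of \<open>z\<close> and \<open>u\<close> is \<open>S k\<close> applied to its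
  successor plus a term in the image of \<open>Jmat ** \<Psi> k\<close>. Symplecticity carries the
  main term over to the successors, and \<open>Psi_J_Psi\<close> kills the product of the two
  corrections.\<close>

lemma lagrange_step:
  assumes k: "k \<le> N" and z: "Jmat *v (z - S k *v z') = \<Psi> k *v f"
    and u: "Jmat *v (u - S k *v u') = \<Psi> k *v g"
  shows "cdot z (Jmat *v u) - cdot z' (Jmat *v u') = cdot z (\<Psi> k *v g) - cdot f (\<Psi> k *v u)"
proof -
  have z2: "z = S k *v z' - Jmat *v (\<Psi> k *v f)" and u2: "u = S k *v u' - Jmat *v (\<Psi> k *v g)"
    using z u by (simp_all add: Jmat_eq_iff diff_eq_eq add.commute)
  have 1: "cdot z (\<Psi> k *v g) = cdot (S k *v z') (\<Psi> k *v g)"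
    using k by (subst z2) (simp add: cdot_diff_left cdot_Jmat Psi_cdot Psi_J_Psi)
  have 2: "cdot f (\<Psi> k *v u) = cdot f (\<Psi> k *v (S k *v u'))"
    using k by (subst u2) (simp add: matrix_vector_mult_diff_distrib Psi_J_Psi)
  have "Jmat *v u = Jmat *v (S k *v u') + \<Psi> k *v g"
    by (subst u2) (simp add: matrix_vector_mult_diff_distrib)
  then have "cdot z (Jmat *v u) = cdot z (Jmat *v (S k *v u')) + cdot z (\<Psi> k *v g)"
    by (simp add: cdot_add_right)
  also have "cdot z (Jmat *v (S k *v u')) = cdot (S k *v z') (Jmat *v (S k *v u')) - cdot (\<Psi> k *v f) (S k *v u')"
    by (subst z2) (simp add: cdot_diff_left cdot_Jmat)
  also have "cdot (S k *v z') (Jmat *v (S k *v u')) = cdot z' (Jmat *v u')"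
    using k by (metis S_J_S cdot_adjoint conj_transpose_conj_transpose)
  finally show ?thesis using k by (simp add: 2 Psi_cdot)
qed

text \<open>The single steps telescope, and both boundary terms vanish because the kernels of
  \<open>\<alpha>\<close> and \<open>\<beta>\<close> are isotropic for \<open>Jmat\<close>.\<close>

lemma lagrange_identity:
  assumes "solution z f" and "solution u g"
  shows "ip z g = ip f u"
proof -
  have "ip z g - ip f u = (\<Sum>k\<in>{0..N}. cdot (z k) (Jmat *v u k) - cdot (z (k + 1)) (Jmat *v u (k + 1)))"
    unfolding semi_inner_def sum_subtractf [symmetric]
    using assms by (intro sum.cong refl lagrange_step [symmetric]) (auto simp: solution_def solves_bvp_def)
  also have "{0..N} = {..<N + 1}" by auto
  also have "(\<Sum>k\<in>{..<N + 1}. cdot (z k) (Jmat *v u k) - cdot (z (k + 1)) (Jmat *v u (k + 1)))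
      = cdot (z 0) (Jmat *v u 0) - cdot (z (N + 1)) (Jmat *v u (N + 1))"
    using sum_lessThan_telescope'[of "\<lambda>k. cdot (z k) (Jmat *v u k)" "N + 1"] by (simp only: Suc_eq_plus1)
  also have "\<dots> = 0"
    using assms Gam_isotropic[OF \<alpha>] Gam_isotropic[OF \<beta>] by (simp add: solution_def solves_bvp_def)
  finally show ?thesis by simp
qed

section \<open>Linearity of the solution relation and its eigenvectors\<close>

lemma solution_add: "solution z f \<Longrightarrow> solution u g \<Longrightarrow> solution (z + u) (f + g)"
  by (simp add: solution_def solves_bvp_def matrix_vector_right_distrib matrix_vector_mult_diff_distrib
      algebra_simps)

lemma solution_scale: "solution z f \<Longrightarrow> solution (seq_scale c z) (seq_scale c f)"
  by (simp add: solution_def solves_bvp_def seq_scale_def vector_scalar_commute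
      flip: vector_ssub_ldistrib)

lemma solution_diff: "solution z f \<Longrightarrow> solution u g \<Longrightarrow> solution (z - u) (f - g)"
  using solution_add[OF _ solution_scale[of u g "- 1"], of z f] by simp

lemma solution_zero: "solution 0 0"
  by (simp add: solution_def solves_bvp_def)

lemma solution_sum: "(\<And>i. i \<in> A \<Longrightarrow> solution (z i) (f i)) \<Longrightarrow> solution (\<Sum>i\<in>A. z i) (\<Sum>i\<in>A. f i)"
proof (induction A rule: infinite_finite_induct)
  case (insert i A)
  then show ?case by (simp only: sum.insert insert_iff solution_add simp_thms)
qed (simp_all only: sum.infinite sum.empty solution_zero not_False_eq_True)

lemma solution_eigen_iff:
  "solution z (seq_scale l z) \<longleftrightarrow>
     solves_S S V N l z \<and> \<alpha> *v z 0 = 0 \<and> \<beta> *v z (N + 1) = 0 \<and> (\<forall>k>N + 1. z k = 0)"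
  using step_iff[where g = 0 and l = l]
  by (auto simp: solution_def solves_bvp_def solves_S_def seq_scale_def)

lemma eigfuns_iff: "z \<in> eigfuns \<longleftrightarrow> z \<noteq> 0 \<and> (\<exists>l. solution z (seq_scale l z))"
proof -
  have "z \<noteq> 0 \<longleftrightarrow> (\<exists>k\<le>N + 1. z k \<noteq> 0)" if "\<forall>k>N + 1. z k = 0"
    using that by (auto simp: fun_eq_iff) (metis not_less)
  then show ?thesis
    by (auto simp: eigenfunctions_def solution_eigen_iff)
qed

section \<open>Null vectors, orthogonality and dimension bounds\<close>

lemma ip_commute: "ip y x = cnj (ip x y)"
  unfolding semi_inner_def cnj_sum
  by (intro sum.cong refl) (metis Psi_cdot atLeastAtMost_iff cdot_commute)

lemma ip_self: "ip x x = of_real (Re (ip x x))" and ip_self_nonneg: "Re (ip x x) \<ge> 0"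
proof -
  have "0 \<le> cdot (x k) (\<Psi> k *v x k)" if "k \<in> {0..N}" for k
    using Psi_psd[OF that] by (simp add: pos_semidef_def)
  then have "0 \<le> Re (cdot (x k) (\<Psi> k *v x k)) \<and> Im (cdot (x k) (\<Psi> k *v x k)) = 0" if "k \<in> {0..N}" for k
    using that by (force simp: less_eq_complex_def)
  then show "ip x x = of_real (Re (ip x x))" "Re (ip x x) \<ge> 0"
    by (auto simp: semi_inner_def complex_eq_iff intro: sum_nonneg)
qed

lemma ip_null:
  assumes "ip x x = 0" and k: "k \<le> N"
  shows "\<Psi> k *v x k = 0"
proof -
  have p: "0 \<le> cdot (x k) (\<Psi> k *v x k)" if "k \<in> {0..N}" for k
    using Psi_psd[OF that] by (simp add: pos_semidef_def)
  have "(\<Sum>k\<in>{0..N}. Re (cdot (x k) (\<Psi> k *v x k))) = 0"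
    using assms(1) by (simp add: semi_inner_def complex_eq_iff)
  then have "Re (cdot (x k) (\<Psi> k *v x k)) = 0"
    using k p by (subst (asm) sum_nonneg_eq_0_iff) (auto simp: less_eq_complex_def)
  then have "cdot (x k) (\<Psi> k *v x k) = 0"
    using p[of k] k by (simp add: complex_eq_iff less_eq_complex_def)
  then show ?thesis using k by (rule Psi_zero[rotated])
qed

lemma ip_null_right: "ip x x = 0 \<Longrightarrow> ip y x = 0"
  using ip_null[of x] by (simp add: semi_inner_def)

lemma supported_independent_card_le:
  assumes X: "\<And>z k. z \<in> X \<Longrightarrow> k > N + 1 \<Longrightarrow> z k = (0 :: complex ^ ('n + 'n))" and "cseq.independent X"
  shows "finite X \<and> card X \<le> 2 * CARD('n) * (N + 2)"
proof -
  have "finite X \<and> card X \<le> (\<Sum>k\<in>{..N + 1}. card (cart_basis :: (complex ^ ('n + 'n)) set))"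
  proof (rule independent_seqs_card_le[OF _ _ \<open>cseq.independent X\<close>])
    show "finite (cart_basis :: (complex ^ ('n + 'n)) set)" by (rule finite_cart_basis)
  qed (use X in \<open>auto simp: span_cart_basis not_le\<close>)
  moreover have "(\<Sum>k\<in>{..N + 1}. card (cart_basis :: (complex ^ ('n + 'n)) set)) = 2 * CARD('n) * (N + 2)"
    by (simp add: card_cart_basis algebra_simps)
  ultimately show ?thesis by metis
qed

lemma orthogonal_independent:
  assumes "finite X" and o: "\<And>x y. x \<in> X \<Longrightarrow> y \<in> X \<Longrightarrow> x \<noteq> y \<Longrightarrow> ip x y = 0"
    and n: "\<And>x. x \<in> X \<Longrightarrow> ip x x \<noteq> 0"
  shows "cseq.independent X"
proof (rule cseq.independent_if_scalars_zero)
  fix f x assume 0: "(\<Sum>x\<in>X. seq_scale (f x) x) = 0" and x: "x \<in> X"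
  have "0 = ip x (\<Sum>x\<in>X. seq_scale (f x) x)" by (simp add: 0 semi_inner_def)
  also have "\<dots> = (\<Sum>y\<in>X. f y * ip x y)" by (simp add: semi_inner_sum_right semi_inner_scale_right)
  also have "\<dots> = (\<Sum>y\<in>X. if y = x then f x * ip x x else 0)"
    using o x by (intro sum.cong) auto
  finally show "f x = 0" using n x \<open>finite X\<close> by simp
qed fact

text \<open>The value \<open>ip y x\<close> depends on \<open>x\<close> only through
  \<open>L x\<close>, so pairing with the members of \<open>X\<close> shows that \<open>L\<close> is
  injective on \<open>X\<close> with independent image. The terms of \<open>L x\<close> lie in the
  ranges of the \<open>\<Psi> k\<close>, where the ranks count dimensions.\<close>

lemma orthogonal_card_le_rank:
  assumes "finite X" and o: "\<And>x y. x \<in> X \<Longrightarrow> y \<in> X \<Longrightarrow> x \<noteq> y \<Longrightarrow> ip x y = 0"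
    and n: "\<And>x. x \<in> X \<Longrightarrow> ip x x \<noteq> 0"
  shows "card X \<le> (\<Sum>k\<in>{0..N}. rank (\<Psi> k))"
proof -
  define L where "L x = (\<lambda>k. if k \<in> {0..N} then \<Psi> k *v x k else 0)" for x :: "nat \<Rightarrow> complex ^ ('n + 'n)"
  have ip_L: "ip y x = (\<Sum>k\<in>{0..N}. cdot (y k) (L x k))" for x y
    unfolding semi_inner_def by (intro sum.cong) (auto simp: L_def)
  have inj: "inj_on L X"
  proof (rule inj_onI, rule ccontr)
    fix x y assume "x \<in> X" "y \<in> X" "L x = L y" "x \<noteq> y"
    then show False using o[of y x] n[of y] by (simp add: ip_L)
  qed
  have "cseq.independent (L ` X)"
  proof (rule cseq.independent_if_scalars_zero)
    fix f w assume 0: "(\<Sum>w\<in>L ` X. seq_scale (f w) w) = 0" and "w \<in> L ` X"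
    then obtain x where x: "x \<in> X" "w = L x" by blast
    have 0: "(\<Sum>y\<in>X. f (L y) *s L y k) = 0" for k
    proof -
      have "(\<Sum>y\<in>X. seq_scale (f (L y)) (L y)) k = 0"
        using 0 by (simp add: sum.reindex[OF inj])
      then show ?thesis by (simp add: sum_seq_apply seq_scale_def)
    qed
    have "(\<Sum>y\<in>X. f (L y) * ip x y) = (\<Sum>y\<in>X. \<Sum>k\<in>{0..N}. cdot (x k) (f (L y) *s L y k))"
      by (simp add: ip_L sum_distrib_left cdot_scale_right)
    also have "\<dots> = (\<Sum>k\<in>{0..N}. cdot (x k) (\<Sum>y\<in>X. f (L y) *s L y k))"
      by (subst sum.swap) (simp add: cdot_sum_right)
    also have "\<dots> = 0" by (simp add: 0)
    finally have "0 = (\<Sum>y\<in>X. f (L y) * ip x y)" by simp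
    also have "\<dots> = (\<Sum>y\<in>X. if y = x then f w * ip x x else 0)"
      using o x by (intro sum.cong) auto
    finally show "f w = 0" using n x \<open>finite X\<close> by simp
  qed (use \<open>finite X\<close> in simp)
  moreover have "\<exists>B. \<forall>k\<in>{0..N}. finite (B k) \<and> card (B k) = rank (\<Psi> k) \<and> range ((*v) (\<Psi> k)) \<subseteq> vec.span (B k)"
  proof (rule bchoice, rule ballI)
    fix k assume "k \<in> {0..N}"
    then have "hermitian (\<Psi> k)" using Psi_psd by (simp add: pos_semidef_def)
    moreover obtain B where "vec.independent B" "range ((*v) (\<Psi> k)) \<subseteq> vec.span B"
      "card B = vec.dim (range ((*v) (\<Psi> k)))"
      using vec.basis_exists[of "range ((*v) (\<Psi> k))"] by metis
    ultimately show "\<exists>B. finite B \<and> card B = rank (\<Psi> k) \<and> range ((*v) (\<Psi> k)) \<subseteq> vec.span B"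
      by (intro exI[of _ B]) (simp add: hermitian_rank vec.finiteI_independent)
  qed
  then obtain B where B: "\<And>k. k \<in> {0..N} \<Longrightarrow> finite (B k)" "\<And>k. k \<in> {0..N} \<Longrightarrow> card (B k) = rank (\<Psi> k)"
    "\<And>k. k \<in> {0..N} \<Longrightarrow> range ((*v) (\<Psi> k)) \<subseteq> vec.span (B k)" by metis
  ultimately have "card (L ` X) \<le> (\<Sum>k\<in>{0..N}. card (B k))"
    by (intro independent_seqs_card_le[THEN conjunct2]) (auto simp: L_def image_subset_iff)
  then show ?thesis by (simp add: card_image inj B)
qed

section \<open>Backward recursion and solvability of the inhomogeneous problem\<close>

primrec backward ::
  "complex \<Rightarrow> (nat \<Rightarrow> complex ^ ('n + 'n)) \<Rightarrow> complex ^ ('n + 'n) \<Rightarrow> nat \<Rightarrow> complex ^ ('n + 'n)" where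
  "backward l g w 0 = w"
| "backward l g w (Suc m) = (S (N - m) + scale_mat l (V (N - m))) *v backward l g w m
     - Jmat *v (\<Psi> (N - m) *v g (N - m))"

lemma backward_affine: "backward l g w m = backward l g 0 m + backward l 0 w m"
  by (induction m) (simp_all add: matrix_vector_right_distrib)

lemma backward_add: "backward l 0 (v + w) m = backward l 0 v m + backward l 0 w m"
  by (induction m) (simp_all add: matrix_vector_right_distrib)

lemma backward_scale: "backward l 0 (c *s w) m = c *s backward l 0 w m"
  by (induction m) (simp_all add: vector_scalar_commute)

text \<open>The system expresses \<open>z k\<close> through \<open>z (k + 1)\<close>, so recursion
  from the terminal value \<open>w\<close> involves no inverse; its \<open>m\<close>-th value
  belongs to index \<open>N + 1 - m\<close>.\<close>

lemma backward_solution: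
  assumes "\<beta> *v w = 0" "\<alpha> *v backward l g w (N + 1) = 0"
  defines "z \<equiv> \<lambda>k. if k \<le> N + 1 then backward l g w (N + 1 - k) else 0"
  shows "solution z (seq_scale l z + g)"
proof -
  have "Jmat *v (z k - S k *v z (k + 1)) = \<Psi> k *v (l *s z k + g k)" if "k \<le> N" for k
  proof -
    have "N + 1 - k = Suc (N - k)" using that by simp
    then show ?thesis
      unfolding step_iff[OF that] using that by (simp add: z_def)
  qed
  then show ?thesis
    using assms(1,2) by (auto simp: solution_def solves_bvp_def seq_scale_def z_def)
qed

text \<open>The boundary conditions impose as many linear equations on \<open>z (N + 1)\<close> as there are unknowns.\<close>

lemma solution_exists:
  assumes regular: "\<And>z. solution z (seq_scale l z) \<Longrightarrow> z = 0"
  shows "\<exists>z. solution z (seq_scale l z + g)"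
proof -
  \<comment> \<open>\<open>T\<close> sends a terminal value to its two boundary residuals, stacked
    to a vector of the same size. Regularity of \<open>l\<close> is injectivity of \<open>T\<close>,
    hence surjectivity.\<close>
  define T :: "complex ^ ('n + 'n) \<Rightarrow> complex ^ ('n + 'n)" where
    "T w = (\<chi> i. case i of Inl a \<Rightarrow> (\<beta> *v w) $ a | Inr a \<Rightarrow> (\<alpha> *v backward l 0 w (N + 1)) $ a)" for w
  have T_eq: "T w = (\<chi> i. case i of Inl a \<Rightarrow> x $ a | Inr a \<Rightarrow> y $ a) \<longleftrightarrow> \<beta> *v w = x \<and> \<alpha> *v backward l 0 w (N + 1) = y"
    for w x y by (auto simp: T_def vec_eq_iff split: sum.splits)
  have lin: "Vector_Spaces.linear (*s) (*s) T"
    by unfold_locales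
      (simp_all add: T_def vec_eq_iff matrix_vector_right_distrib backward_add backward_scale
        vector_scalar_commute del: backward.simps split: sum.split)
  have "w = 0" if "T w = 0" for w
  proof -
    have 1: "\<beta> *v w = 0" "\<alpha> *v backward l 0 w (N + 1) = 0"
      using that T_eq[of w 0 0] by (simp_all add: vec_eq_iff del: backward.simps split: sum.splits)
    define z where "z = (\<lambda>k. if k \<le> N + 1 then backward l 0 w (N + 1 - k) else 0)"
    have "solution z (seq_scale l z)"
      using backward_solution[OF 1] by (simp add: z_def)
    then have "z (N + 1) = 0" using regular[of z] by simp
    then show "w = 0" by (simp add: z_def)
  qed
  then have "inj T"
    using vec.linear_inj_iff_eq_0[OF lin] by blast
  then have "surj T" by (rule vec.linear_inj_imp_surj[OF lin])
  \<comment> \<open>The prescribed lower half cancels the \<open>\<alpha>\<close>-residual of the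
    particular solution with terminal value zero.\<close>
  then obtain w where w: "T w = (\<chi> i. case i of Inl a \<Rightarrow> (0 :: complex ^ 'n) $ a | Inr a \<Rightarrow> (- (\<alpha> *v backward l g 0 (N + 1))) $ a)"
    by (metis surjD)
  then have "\<beta> *v w = 0" "\<alpha> *v backward l g w (N + 1) = 0"
    unfolding T_eq backward_affine[of l g w] by (simp_all add: matrix_vector_right_distrib del: backward.simps)
  from backward_solution[OF this] show ?thesis by blast
qed

text \<open>A basis chosen among the eigenfunctions attains the supremum, since any independent set
  of eigenfunctions lies in its span.\<close>

lemma num_eigenfunctions_eq_dim:
  "num_eigenfunctions S V N \<alpha> \<beta> = enat (cseq.dim eigfuns)"
  and dim_eigfuns_le: "cseq.dim eigfuns \<le> 2 * CARD('n) * (N + 2)"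
proof -
  obtain B where B: "B \<subseteq> eigfuns" "cseq.independent B" "eigfuns \<subseteq> cseq.span B" "card B = cseq.dim eigfuns"
    by (rule cseq.basis_exists)
  have fin: "finite X \<and> card X \<le> 2 * CARD('n) * (N + 2)" if "X \<subseteq> eigfuns" "cseq.independent X" for X
    using that by (intro supported_independent_card_le) (auto simp: eigenfunctions_def)
  show "cseq.dim eigfuns \<le> 2 * CARD('n) * (N + 2)" using fin[OF B(1,2)] B(4) by simp
  have "finite B" using fin[OF B(1,2)] by simp
  show "num_eigenfunctions S V N \<alpha> \<beta> = enat (cseq.dim eigfuns)"
    unfolding num_eigenfunctions_def
  proof (rule antisym)
    show "(SUP X\<in>{X. X \<subseteq> eigfuns \<and> cseq.independent X}. if finite X then enat (card X) else \<infinity>) \<le> enat (cseq.dim eigfuns)"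
    proof (rule SUP_least)
      fix X assume "X \<in> {X. X \<subseteq> eigfuns \<and> cseq.independent X}"
      then have "finite X \<and> card X \<le> card B"
        using B(3) by (intro cseq.independent_span_bound[OF \<open>finite B\<close>]) auto
      then show "(if finite X then enat (card X) else \<infinity>) \<le> enat (cseq.dim eigfuns)"
        by (simp add: B(4))
    qed
    show "enat (cseq.dim eigfuns) \<le> (SUP X\<in>{X. X \<subseteq> eigfuns \<and> cseq.independent X}. if finite X then enat (card X) else \<infinity>)"
      using B \<open>finite B\<close> by (intro SUP_upper2[of B]) auto
  qed
qed

end

section \<open>Orthonormal eigenfunctions and expansion\<close>

locale atkinson_bvp = symplectic_bvp S V \<alpha> \<beta> N
  for S V :: "nat \<Rightarrow> complex ^ ('n::finite + 'n) ^ ('n + 'n)" and \<alpha> \<beta> N +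
  assumes weak_atkinson: "weak_atkinson S V N \<alpha>"
begin

text \<open>A null eigenfunction satisfies \<open>z k = S k *v z (k + 1)\<close> and \<open>\<Psi> k *v z k = 0\<close>, so it solves the
  system for every spectral parameter, in particular for the one in the weak Atkinson condition.\<close>

lemma eigenfunction_not_null:
  assumes z: "solution z (seq_scale l z)" and null: "ip z z = 0"
  shows "z = 0"
proof -
  obtain l0 Z where Z: "solves_S_mat S V N l0 Z" "Z 0 = - (Jmat ** conj_transpose \<alpha>)"
    and pos: "\<And>\<eta>. \<eta> \<noteq> 0 \<Longrightarrow> 0 < ip (\<lambda>k. Z k *v \<eta>) (\<lambda>k. Z k *v \<eta>)"
    using weak_atkinson by (auto simp: weak_atkinson_def)
  have "solution z (seq_scale l0 z)"
    using z ip_null[OF null]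
    by (simp add: solution_def solves_bvp_def seq_scale_def vector_scalar_commute)
  then have z0: "solves_S S V N l0 z" "\<alpha> *v z 0 = 0" "\<And>k. k > N + 1 \<Longrightarrow> z k = 0"
    by (auto simp: solution_eigen_iff)
  \<comment> \<open>By \<open>Gam_kernel_Lagrangian\<close> these are the coordinates of
    \<open>z 0\<close> in the columns of \<open>Z 0\<close>.\<close>
  define \<eta> where "\<eta> = \<alpha> *v (Jmat *v z 0)"
  have zZ: "z k = Z k *v \<eta>" if "k \<le> N + 1" for k
    using that
  proof (induction k)
    case 0
    show ?case using Gam_kernel_Lagrangian[OF \<alpha> z0(2)] by (simp add: Z(2) \<eta>_def)
  next
    case (Suc k)
    let ?M = "S k + scale_mat l0 (V k)"
    have k: "k \<le> N" using Suc.prems by simp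
    \<comment> \<open>Passing from index \<open>k\<close> to \<open>k + 1\<close> runs against the
      recursion and needs an injective coefficient matrix. By \<open>step_iff\<close> with
      \<open>z = 0\<close>, a kernel vector is also one of \<open>S k\<close>.\<close>
    have "x = 0" if "?M *v x = 0" for x
    proof -
      have "Jmat *v (0 - S k *v x) = 0"
        using step_iff[OF k, of 0 x l0 0] that by simp
      then have "S k *v x = 0" by (simp add: Jmat_eq_iff)
      then have "Jmat *v x = 0" using S_J_S[OF k, of x] by simp
      then show ?thesis by (simp add: Jmat_eq_iff)
    qed
    moreover have "?M *v (z (Suc k) - Z (Suc k) *v \<eta>) = 0"
      using z0(1) Z(1) Suc k
      by (simp add: solves_S_def solves_S_mat_def matrix_vector_mult_diff_distrib matrix_vector_mul_assoc)
    ultimately show ?case by (metis right_minus_eq)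
  qed
  then have "ip (\<lambda>k. Z k *v \<eta>) (\<lambda>k. Z k *v \<eta>) = ip z z"
    unfolding semi_inner_def by (intro sum.cong) auto
  then have "\<eta> = 0" using pos[of \<eta>] null by auto
  then have "z k = 0" for k using zZ[of k] z0(3)[of k] by (cases "k \<le> N + 1") auto
  then show ?thesis by (simp add: fun_eq_iff)
qed

section \<open>Real eigenvalues, orthogonality and completeness\<close>

lemma eigenvalue_real:
  assumes z: "solution z (seq_scale l z)" and "z \<noteq> 0"
  shows "cnj l = l"
proof -
  have "l * ip z z = cnj l * ip z z"
    using lagrange_identity[OF z z] by (simp add: semi_inner_scale_left semi_inner_scale_right)
  then show ?thesis using eigenfunction_not_null[OF z] \<open>z \<noteq> 0\<close> by auto
qed

lemma eigenfunctions_orthogonal: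
  assumes z: "solution z (seq_scale l z)" and "z \<noteq> 0" and u: "solution u (seq_scale m u)" and "l \<noteq> m"
  shows "ip z u = 0"
proof -
  have "m * ip z u = l * ip z u"
    using lagrange_identity[OF z u] eigenvalue_real[OF z \<open>z \<noteq> 0\<close>]
    by (simp add: semi_inner_scale_left semi_inner_scale_right)
  then show ?thesis using \<open>l \<noteq> m\<close> by simp
qed

text \<open>Otherwise every natural number would be an eigenvalue, giving more mutually orthogonal
  eigenfunctions than the sequence space has dimensions. A real value is sought because it makes the
  resolvent symmetric.\<close>

lemma real_regular_value:
  obtains l where "cnj l = l" "\<And>z. solution z (seq_scale l z) \<Longrightarrow> z = 0"
proof (rule ccontr)
  assume "\<not> thesis"
  have "\<exists>z. solution z (seq_scale (of_nat j) z) \<and> z \<noteq> 0" for j :: nat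
  proof (rule ccontr)
    assume "\<not> ?thesis"
    then have thesis by (intro that[of "of_nat j"]) auto
    with \<open>\<not> thesis\<close> show False ..
  qed
  then obtain e where e: "\<And>j :: nat. solution (e j) (seq_scale (of_nat j) (e j))" "\<And>j. e j \<noteq> 0"
    by metis
  define D where "D = 2 * CARD('n) * (N + 2)"
  have n: "ip (e j) (e j) \<noteq> 0" for j using eigenfunction_not_null[OF e(1)] e(2) by metis
  have o: "ip (e i) (e j) = 0" if "i \<noteq> j" for i j
    using eigenfunctions_orthogonal[OF e(1) e(2) e(1)] that by simp
  have "inj e" using n o by (metis injI)
  have "cseq.independent (e ` {..D})"
    by (rule orthogonal_independent) (auto simp: n intro!: o)
  moreover have "x k = 0" if "x \<in> e ` {..D}" "k > N + 1" for x k
    using that e(1) by (auto simp: solution_def)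
  ultimately have "card (e ` {..D}) \<le> D"
    using supported_independent_card_le[of "e ` {..D}"] by (simp add: D_def)
  then show False using \<open>inj e\<close> by (simp add: card_image inj_on_subset)
qed

text \<open>This completeness statement is meant for the remainder of an expansion. The semi-inner
  product may be degenerate, so nilpotency followed by a descent through null vectors replaces
  diagonalisation.\<close>

lemma solution_orthogonal_to_eigfuns_null:
  assumes z: "solution z f" and orth: "\<And>e. e \<in> eigfuns \<Longrightarrow> ip e z = 0"
  shows "ip z z = 0"
proof -
  obtain l where l: "cnj l = l" and regular: "\<And>z. solution z (seq_scale l z) \<Longrightarrow> z = 0"
    by (rule real_regular_value) blast
  obtain R where R: "\<And>g. solution (R g) (seq_scale l (R g) + g)"
    using solution_exists[OF regular] by metis
  \<comment> \<open>\<open>R\<close> is merely a choice function so far; uniqueness makes it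
    linear.\<close>
  have R_unique: "u = R g" if "solution u (seq_scale l u + g)" for u g
  proof -
    have "seq_scale l u + g - (seq_scale l (R g) + g) = seq_scale l (u - R g)"
      by (simp only: cseq.scale_right_diff_distrib) (simp only: add_diff_cancel_right)
    then have "solution (u - R g) (seq_scale l (u - R g))"
      using solution_diff[OF that R[of g]] by (simp only:)
    from regular[OF this] show ?thesis by (simp only: right_minus_eq)
  qed
  have R_add: "R (x + y) = R x + R y" for x y
  proof (rule R_unique [symmetric])
    have "seq_scale l (R x) + x + (seq_scale l (R y) + y) = seq_scale l (R x + R y) + (x + y)"
      by (simp only: cseq.scale_right_distrib add_ac)
    then show "solution (R x + R y) (seq_scale l (R x + R y) + (x + y))"
      using solution_add[OF R[of x] R[of y]] by (simp only:)
  qed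
  have R_scale: "R (seq_scale c x) = seq_scale c (R x)" for c x
  proof (rule R_unique [symmetric])
    have "seq_scale c (seq_scale l (R x) + x) = seq_scale l (seq_scale c (R x)) + seq_scale c x"
      by (simp only: cseq.scale_right_distrib cseq.scale_scale mult.commute)
    then show "solution (seq_scale c (R x)) (seq_scale l (seq_scale c (R x)) + seq_scale c x)"
      using solution_scale[OF R[of x], of c] by (simp only:)
  qed
  have R_symmetric: "ip (R x) y = ip x (R y)" for x y
    using lagrange_identity[OF R[of x] R[of y]]
    by (simp only: semi_inner_add_left semi_inner_add_right semi_inner_scale_left semi_inner_scale_right l)
      simp
  \<comment> \<open>The support condition confines the iterates of \<open>R\<close> to a
    finite-dimensional space.\<close>
  define P where "P v \<longleftrightarrow> (\<forall>k>N + 1. v k = 0) \<and> (\<forall>e\<in>eigfuns. ip e v = 0)" for v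
  have R_orth: "ip e (R v) = 0" if "ip e v = 0" and "e \<in> eigfuns" for e v
  proof -
    obtain m where m: "solution e (seq_scale m e)" and "e \<noteq> 0" using \<open>e \<in> eigfuns\<close> by (auto simp: eigfuns_iff)
    then have "m \<noteq> l" using regular by blast
    have "l * ip e (R v) = m * ip e (R v)"
      using lagrange_identity[OF m R[of v]] eigenvalue_real[OF m \<open>e \<noteq> 0\<close>] \<open>ip e v = 0\<close>
      by (simp only: semi_inner_add_right semi_inner_scale_left semi_inner_scale_right) simp
    then show ?thesis using \<open>m \<noteq> l\<close> by simp
  qed
  have P_invariant: "P (R v - seq_scale \<mu> v)" if "P v" for v \<mu>
  proof -
    have "(R v - seq_scale \<mu> v) k = 0" if "k > N + 1" for k
      using R[of v] \<open>P v\<close> that by (simp add: P_def solution_def seq_scale_def)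
    moreover have "ip e (R v - seq_scale \<mu> v) = 0" if "e \<in> eigfuns" for e
      using \<open>P v\<close> that R_orth[of e v] unfolding P_def semi_inner_diff_right semi_inner_scale_right by simp
    ultimately show ?thesis by (auto simp only: P_def)
  qed
  have P_eigen: "x = 0" if "\<mu> \<noteq> 0" "P x" "R x = seq_scale \<mu> x" for \<mu> x
  proof (rule ccontr)
    assume "x \<noteq> 0"
    \<comment> \<open>Dividing the resolvent equation by \<open>\<mu>\<close> shows that
      \<open>x\<close> belongs to the eigenvalue \<open>l + 1 / \<mu>\<close>.\<close>
    have "seq_scale (1 / \<mu>) (seq_scale \<mu> x) = x"
      using \<open>\<mu> \<noteq> 0\<close> by (simp add: seq_scale_def fun_eq_iff vec_eq_iff)
    moreover have "seq_scale (1 / \<mu>) (seq_scale l (seq_scale \<mu> x) + x) = seq_scale (l + 1 / \<mu>) x"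
      using \<open>\<mu> \<noteq> 0\<close> by (simp add: seq_scale_def fun_eq_iff vec_eq_iff algebra_simps)
    ultimately have s: "solution x (seq_scale (l + 1 / \<mu>) x)"
      using solution_scale[OF R[of x], of "1 / \<mu>"] that(3) by (simp only:)
    with \<open>x \<noteq> 0\<close> have "x \<in> eigfuns" unfolding eigfuns_iff by blast
    then have "ip x x = 0" using \<open>P x\<close> by (simp add: P_def)
    from eigenfunction_not_null[OF s this] \<open>x \<noteq> 0\<close> show False by simp
  qed
  have "P z" using z orth by (simp add: P_def solution_def)
  define g where "g = f - seq_scale l z"
  have zR: "z = R g" using z by (intro R_unique) (simp only: g_def add_diff_eq add_diff_cancel_left')
  define D where "D = 2 * CARD('n) * (N + 2)"
  have "P ((R ^^ i) z)" for i
  proof (induction i)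
    case (Suc i)
    then show ?case using P_invariant[of "(R ^^ i) z" 0] by simp
  qed (use \<open>P z\<close> in simp)
  then have "card X \<le> D" if "X \<subseteq> range (\<lambda>i. (R ^^ i) z)" "cseq.independent X" for X
    using that supported_independent_card_le[of X] unfolding D_def P_def by blast
  then obtain c where c: "\<exists>i\<le>D. c i \<noteq> 0" "(\<Sum>i\<le>D. seq_scale (c i) ((R ^^ i) z)) = 0"
    by (rule dependent_family)
  \<comment> \<open>The relation among the first \<open>D + 1\<close> iterates becomes an
    annihilating polynomial.\<close>
  define p where "p = Poly (map c [0..<Suc D])"
  have p: "coeff p i = (if i \<le> D then c i else 0)" for i
    by (simp add: p_def nth_default_def del: upt_Suc)
  have "\<exists>m. (R ^^ m) z = 0"
  proof (rule nilpotent_if_no_nonzero_eigenvalue[OF R_add R_scale P_invariant P_eigen \<open>P z\<close>])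
    show "p \<noteq> 0" using c(1) p by (metis coeff_0)
    show "degree p \<le> D" by (rule degree_le) (simp add: p)
    show "(\<Sum>i\<le>D. seq_scale (coeff p i) ((R ^^ i) z)) = 0"
      using c(2) by (simp add: p)
  qed
  then obtain m where m: "(R ^^ m) z = 0" ..
  \<comment> \<open>Symmetry moves one \<open>R\<close> across the product, pairing
    \<open>(R ^^ m) g\<close> with a null vector. The descent ends at \<open>R g\<close>, which is
    \<open>z\<close>.\<close>
  have descent: "ip (R g) (R g) = 0" if "ip ((R ^^ Suc m) g) ((R ^^ Suc m) g) = 0" for m
    using that
  proof (induction m)
    case (Suc m)
    have "ip ((R ^^ Suc m) g) ((R ^^ Suc m) g) = ip ((R ^^ m) g) ((R ^^ Suc (Suc m)) g)"
      using R_symmetric[of "(R ^^ m) g" "(R ^^ Suc m) g"] by (simp only: funpow.simps comp_apply)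
    also have "\<dots> = 0" using Suc.prems by (rule ip_null_right)
    finally show ?case by (rule Suc.IH)
  qed simp
  have "(R ^^ Suc m) g = 0" using m by (simp only: zR funpow_Suc_right comp_apply)
  then have "ip ((R ^^ Suc m) g) ((R ^^ Suc m) g) = 0" by (simp only: semi_inner_def) simp
  from descent[OF this] show ?thesis by (simp only: zR)
qed

text \<open>An orthonormal set of eigenfunctions of maximal size spans: the part of an eigenfunction
  orthogonal to the set stays in the same eigenspace and, if nonzero, could be normalised and
  added.\<close>

lemma orthonormal_eigenbasis:
  obtains X where "finite X" "X \<subseteq> eigfuns" "cseq.independent X" "eigfuns \<subseteq> cseq.span X"
    "\<And>x y. x \<in> X \<Longrightarrow> y \<in> X \<Longrightarrow> ip x y = (if x = y then 1 else 0)"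
proof -
  define Q where "Q X \<longleftrightarrow> finite X \<and> X \<subseteq> eigfuns \<and> (\<forall>x\<in>X. \<forall>y\<in>X. ip x y = (if x = y then 1 else 0))" for X
  have indep: "cseq.independent X" if "Q X" for X
    using that by (intro orthogonal_independent) (auto simp: Q_def)
  have "card X < Suc (2 * CARD('n) * (N + 2))" if "Q X" for X
    using supported_independent_card_le[OF _ indep[OF that]] that
    by (auto simp: Q_def eigenfunctions_def less_Suc_eq_le)
  moreover have "Q {}" by (simp add: Q_def)
  ultimately obtain X where X: "Q X" and max: "\<And>Y. Q Y \<Longrightarrow> card Y \<le> card X"
    using Lattices_Big.ex_has_greatest_nat[of Q "{}" card "Suc (2 * CARD('n) * (N + 2))"] by blast
  have "finite X" "X \<subseteq> eigfuns" and ip_X: "\<And>x y. x \<in> X \<Longrightarrow> y \<in> X \<Longrightarrow> ip x y = (if x = y then 1 else 0)"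
    using X by (auto simp: Q_def)
  have "e \<in> cseq.span X" if "e \<in> eigfuns" for e
  proof -
    obtain l where l: "solution e (seq_scale l e)" and "e \<noteq> 0" using \<open>e \<in> eigfuns\<close> by (auto simp: eigfuns_iff)
    define s where "s = (\<Sum>x\<in>X. seq_scale (ip x e) x)"
    \<comment> \<open>Members of \<open>X\<close> with another eigenvalue are orthogonal to
      \<open>e\<close>, so only the eigenspace of \<open>l\<close> contributes to
      \<open>s\<close>.\<close>
    have "solution (seq_scale (ip x e) x) (seq_scale l (seq_scale (ip x e) x))" if "x \<in> X" for x
    proof (cases "ip x e = 0")
      case True
      have "seq_scale (ip x e) x = 0" "seq_scale l (seq_scale (ip x e) x) = 0"
        by (simp_all add: True seq_scale_def fun_eq_iff)
      then show ?thesis using solution_zero by (simp only:)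
    next
      case False
      obtain m where m: "solution x (seq_scale m x)" and "x \<noteq> 0"
        using \<open>x \<in> X\<close> \<open>X \<subseteq> eigfuns\<close> eigfuns_iff by blast
      then have "m = l" using eigenfunctions_orthogonal[OF m \<open>x \<noteq> 0\<close> l] False by blast
      then show ?thesis using solution_scale[OF m, of "ip x e"] by (simp only: cseq.scale_left_commute)
    qed
    then have "solution s (\<Sum>x\<in>X. seq_scale l (seq_scale (ip x e) x))"
      unfolding s_def by (rule solution_sum)
    also have "(\<Sum>x\<in>X. seq_scale l (seq_scale (ip x e) x)) = seq_scale l s"
      by (simp only: s_def cseq.scale_sum_right)
    finally have d: "solution (e - s) (seq_scale l (e - s))"
      using solution_diff[OF l] by (simp only: cseq.scale_right_diff_distrib)
    have orth: "ip x (e - s) = 0" if "x \<in> X" for x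
    proof -
      have "ip x s = (\<Sum>y\<in>X. if y = x then ip x e else 0)"
        unfolding s_def semi_inner_sum_right semi_inner_scale_right
        using ip_X that by (intro sum.cong) auto
      then show ?thesis using that \<open>finite X\<close> by (simp only: semi_inner_diff_right) simp
    qed
    have "e - s = 0"
    proof (rule ccontr)
      assume n: "e - s \<noteq> 0"
      define a where "a = Re (ip (e - s) (e - s))"
      have a: "ip (e - s) (e - s) = of_real a" unfolding a_def by (rule ip_self)
      have "a \<noteq> 0" using a eigenfunction_not_null[OF d] n by auto
      moreover have "a \<ge> 0" unfolding a_def by (rule ip_self_nonneg)
      ultimately have "a > 0" by simp
      define c where "c = complex_of_real (1 / sqrt a)"
      define y where "y = seq_scale c (e - s)"
      have "c \<noteq> 0" using \<open>a > 0\<close> by (simp add: c_def)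
      have "solution y (seq_scale l y)"
        using solution_scale[OF d, of c] by (simp only: y_def cseq.scale_left_commute)
      moreover have "y \<noteq> 0" using n \<open>c \<noteq> 0\<close> unfolding y_def by (simp only: cseq.scale_eq_0_iff) simp
      ultimately have "y \<in> eigfuns" unfolding eigfuns_iff by blast
      have "ip y y = cnj c * (c * of_real a)"
        by (simp only: y_def semi_inner_scale_left semi_inner_scale_right a mult.left_commute)
      also have "\<dots> = of_real (1 / sqrt a * (1 / sqrt a) * a)"
        by (simp only: c_def complex_cnj_complex_of_real of_real_mult mult.assoc)
      also have "1 / sqrt a * (1 / sqrt a) * a = 1"
        using \<open>a > 0\<close> by simp
      finally have yy: "ip y y = 1" by simp
      have xy: "ip x y = 0" if "x \<in> X" for x
        using orth[OF that] by (simp only: y_def semi_inner_scale_right) simp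
      then have yx: "ip y x = 0" if "x \<in> X" for x
        using that by (subst ip_commute) simp
      have "y \<notin> X" using xy[of y] yy by auto
      have "Q (insert y X)"
        using \<open>finite X\<close> \<open>X \<subseteq> eigfuns\<close> ip_X yy xy yx \<open>y \<in> eigfuns\<close> \<open>y \<notin> X\<close>
        unfolding Q_def by auto
      from max[OF this] show False using \<open>y \<notin> X\<close> \<open>finite X\<close> by simp
    qed
    then have "e = s" by (simp only: right_minus_eq)
    moreover have "s \<in> cseq.span X"
      unfolding s_def by (intro cseq.span_sum cseq.span_scale cseq.span_base)
    ultimately show ?thesis by simp
  qed
  then show ?thesis
    using that[OF \<open>finite X\<close> \<open>X \<subseteq> eigfuns\<close> indep[OF X] _ ip_X] by blast
qed

section \<open>The rank bound and the eigenfunction expansion\<close>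

lemma dim_eigfuns_le_rank:
  "cseq.dim eigfuns \<le> min (CARD('n) * (N + 1)) (\<Sum>k\<in>{0..N}. rank (\<Psi> k))"
proof -
  obtain X where X: "finite X" "X \<subseteq> eigfuns" "cseq.independent X" "eigfuns \<subseteq> cseq.span X"
    "\<And>x y. x \<in> X \<Longrightarrow> y \<in> X \<Longrightarrow> ip x y = (if x = y then 1 else 0)"
    by (rule orthonormal_eigenbasis) blast
  have "cseq.dim eigfuns = card X"
    by (rule cseq.dim_unique) (use X in auto)
  also have "\<dots> \<le> (\<Sum>k\<in>{0..N}. rank (\<Psi> k))"
    using X by (intro orthogonal_card_le_rank) auto
  finally have 1: "cseq.dim eigfuns \<le> (\<Sum>k\<in>{0..N}. rank (\<Psi> k))" .
  have "(\<Sum>k\<in>{0..N}. rank (\<Psi> k)) \<le> (\<Sum>k\<in>{0..N}. CARD('n))"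
    by (intro sum_mono rank_Psi_le) simp
  then show ?thesis using 1 by (simp add: algebra_simps)
qed

lemma orthonormal_eigensystem_exists:
  "\<exists>z. orthonormal_eigensystem S V N \<alpha> \<beta> (cseq.dim eigfuns) z"
proof -
  obtain X where X: "finite X" "X \<subseteq> eigfuns" "cseq.independent X" "eigfuns \<subseteq> cseq.span X"
    "\<And>x y. x \<in> X \<Longrightarrow> y \<in> X \<Longrightarrow> ip x y = (if x = y then 1 else 0)"
    by (rule orthonormal_eigenbasis) blast
  have "cseq.dim eigfuns = card X"
    by (rule cseq.dim_unique) (use X in auto)
  then have "card {1..cseq.dim eigfuns} = card X" by simp
  then obtain z where z: "bij_betw z {1..cseq.dim eigfuns} X"
    using finite_same_card_bij[OF finite_atLeastAtMost X(1)] by blast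
  then have inj: "inj_on z {1..cseq.dim eigfuns}" and im: "z ` {1..cseq.dim eigfuns} = X"
    by (simp_all add: bij_betw_def)
  have "ip (z i) (z j) = (if i = j then 1 else 0)" if "i \<in> {1..cseq.dim eigfuns}" "j \<in> {1..cseq.dim eigfuns}" for i j
  proof -
    have "z i \<in> X" "z j \<in> X" using im that by blast+
    from X(5)[OF this] show ?thesis by (simp only: inj_on_eq_iff[OF inj that])
  qed
  then have "orthonormal_eigensystem S V N \<alpha> \<beta> (cseq.dim eigfuns) z"
    unfolding orthonormal_eigensystem_def im using X inj by blast
  then show ?thesis by blast
qed

text \<open>The remainder solves some inhomogeneous problem, because each eigenfunction does, and it
  is orthogonal to all eigenfunctions; completeness makes it null.\<close>

lemma eigenfunction_expansion:
  assumes z: "orthonormal_eigensystem S V N \<alpha> \<beta> (cseq.dim eigfuns) z"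
    and zh: "solves_bvp S V N \<alpha> \<beta> f zh"
    and c: "\<And>j. j \<in> {1..cseq.dim eigfuns} \<Longrightarrow> c j = ip (z j) zh"
  shows "semi_norm (Psi S V) N (\<lambda>k. zh k - (\<Sum>j=1..cseq.dim eigfuns. c j *s z j k)) = 0"
proof -
  let ?r = "cseq.dim eigfuns"
  have z_eig: "z ` {1..?r} \<subseteq> eigfuns" and inj: "inj_on z {1..?r}" and indep: "cseq.independent (z ` {1..?r})"
    and ip_z: "\<And>i j. i \<in> {1..?r} \<Longrightarrow> j \<in> {1..?r} \<Longrightarrow> ip (z i) (z j) = (if i = j then 1 else 0)"
    using z by (auto simp: orthonormal_eigensystem_def)
  \<comment> \<open>An eigenfunction outside the span would yield an independent set larger than the
    supremum.\<close>
  have span: "eigfuns \<subseteq> cseq.span (z ` {1..?r})"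
  proof (rule ccontr)
    assume "\<not> ?thesis"
    then obtain e where e: "e \<in> eigfuns" "e \<notin> cseq.span (z ` {1..?r})" by blast
    have ind: "cseq.independent (insert e (z ` {1..?r}))"
      using indep e by (simp add: cseq.independent_insert)
    have "e \<notin> z ` {1..?r}" using e(2) cseq.span_base by blast
    then have "card (insert e (z ` {1..?r})) = Suc ?r"
      using inj by (simp add: card_image del: One_nat_def)
    moreover have "enat (card (insert e (z ` {1..?r}))) \<le> num_eigenfunctions S V N \<alpha> \<beta>"
      unfolding num_eigenfunctions_def
      using ind e(1) z_eig by (intro SUP_upper2[of "insert e (z ` {1..?r})"]) auto
    ultimately show False by (simp add: num_eigenfunctions_eq_dim)
  qed
  \<comment> \<open>The values of \<open>zh\<close> beyond \<open>N + 1\<close> are arbitrary;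
    cutting them off is invisible to the semi-inner product.\<close>
  define zt where "zt = (\<lambda>k. if k \<le> N + 1 then zh k else 0)"
  have zt: "solution zt f"
    using zh by (auto simp: solution_def solves_bvp_def zt_def)
  have ip_zt: "ip y zt = ip y zh" for y
    unfolding semi_inner_def by (intro sum.cong) (auto simp: zt_def)
  have "\<forall>j\<in>{1..?r}. \<exists>g. solution (z j) g"
    using z_eig unfolding eigfuns_iff image_subset_iff by blast
  then obtain g where g: "\<And>j. j \<in> {1..?r} \<Longrightarrow> solution (z j) (g j)" by metis
  define u where "u = zt - (\<Sum>j=1..?r. seq_scale (c j) (z j))"
  have u: "solution u (f - (\<Sum>j=1..?r. seq_scale (c j) (g j)))"
    unfolding u_def by (intro solution_diff zt solution_sum solution_scale g)
  have orth_z: "ip (z i) u = 0" if "i \<in> {1..?r}" for i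
  proof -
    have "ip (z i) (\<Sum>j=1..?r. seq_scale (c j) (z j)) = (\<Sum>j=1..?r. if j = i then c i else 0)"
      unfolding semi_inner_sum_right semi_inner_scale_right
      using ip_z that by (intro sum.cong) auto
    then show ?thesis
      using that c[OF that] unfolding u_def semi_inner_diff_right by (simp add: ip_zt)
  qed
  have "ip e u = 0" if "e \<in> cseq.span (z ` {1..?r})" for e
    using that
  proof (induction rule: cseq.span_induct_alt)
    case base
    show ?case by (simp add: semi_inner_def)
  next
    case (step c x y)
    then show ?case using orth_z unfolding semi_inner_add_left semi_inner_scale_left by auto
  qed
  then have "ip u u = 0"
    using span by (intro solution_orthogonal_to_eigfuns_null[OF u]) blast
  moreover have "ip u u = ip (\<lambda>k. zh k - (\<Sum>j=1..?r. c j *s z j k)) (\<lambda>k. zh k - (\<Sum>j=1..?r. c j *s z j k))"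
    unfolding semi_inner_def
    by (intro sum.cong) (auto simp: u_def zt_def sum_seq_apply seq_scale_def)
  ultimately show ?thesis by (simp add: semi_norm_def)
qed

end

theorem theorem1p2:
  fixes S V :: "nat \<Rightarrow> complex ^ ('n::finite + 'n) ^ ('n + 'n)"
    and \<alpha> \<beta> :: "complex ^ ('n + 'n) ^ 'n"
    and N :: nat
  assumes "\<alpha> \<in> Gam" and "\<beta> \<in> Gam"
    and "\<And>k. k \<in> {0..N} \<Longrightarrow> conj_transpose (S k) ** Jmat ** S k = Jmat"
    and "\<And>k. k \<in> {0..N} \<Longrightarrow> hermitian (conj_transpose (V k) ** Jmat ** S k)"
    and "\<And>k. k \<in> {0..N} \<Longrightarrow> conj_transpose (V k) ** Jmat ** V k = 0"
    and "\<And>k. k \<in> {0..N} \<Longrightarrow> pos_semidef (Psi S V k)"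
  shows "\<exists>r::nat. num_eigenfunctions S V N \<alpha> \<beta> = enat r \<and>
    0 \<le> r \<and> r \<le> 2 * CARD('n) * (N + 2) \<and>
    (weak_atkinson S V N \<alpha> \<longrightarrow>
       r \<le> min (CARD('n) * (N + 1)) (\<Sum>k\<in>{0..N}. rank (Psi S V k)) \<and>
       (\<exists>z. orthonormal_eigensystem S V N \<alpha> \<beta> r z) \<and>
       (\<forall>z. orthonormal_eigensystem S V N \<alpha> \<beta> r z \<longrightarrow>
          (\<forall>f zh. solves_bvp S V N \<alpha> \<beta> f zh \<longrightarrow>
             (\<forall>c. (\<forall>j\<in>{1..r}. c j = (\<Sum>k\<in>{0..N}. cdot (z j k) (Psi S V k *v zh k))) \<longrightarrow>
                semi_norm (Psi S V) N (\<lambda>k. zh k - (\<Sum>j=1..r. c j *s z j k)) = 0))))"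
proof -
  interpret symplectic_bvp S V \<alpha> \<beta> N
    by unfold_locales (fact assms)+
  have atkinson: "cseq.dim eigfuns \<le> min (CARD('n) * (N + 1)) (\<Sum>k\<in>{0..N}. rank (\<Psi> k)) \<and>
      (\<exists>z. orthonormal_eigensystem S V N \<alpha> \<beta> (cseq.dim eigfuns) z) \<and>
      (\<forall>z. orthonormal_eigensystem S V N \<alpha> \<beta> (cseq.dim eigfuns) z \<longrightarrow>
        (\<forall>f zh. solves_bvp S V N \<alpha> \<beta> f zh \<longrightarrow>
          (\<forall>c. (\<forall>j\<in>{1..cseq.dim eigfuns}. c j = (\<Sum>k\<in>{0..N}. cdot (z j k) (\<Psi> k *v zh k))) \<longrightarrow>
             semi_norm \<Psi> N (\<lambda>k. zh k - (\<Sum>j=1..cseq.dim eigfuns. c j *s z j k)) = 0)))"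
    if "weak_atkinson S V N \<alpha>"
  proof -
    interpret atkinson_bvp S V \<alpha> \<beta> N
      by unfold_locales fact
    show ?thesis
      using dim_eigfuns_le_rank orthonormal_eigensystem_exists
    proof (intro conjI allI impI)
      fix z f zh c
      assume o: "orthonormal_eigensystem S V N \<alpha> \<beta> (cseq.dim eigfuns) z"
        and b: "solves_bvp S V N \<alpha> \<beta> f zh"
        and c: "\<forall>j\<in>{1..cseq.dim eigfuns}. c j = (\<Sum>k\<in>{0..N}. cdot (z j k) (\<Psi> k *v zh k))"
      show "semi_norm \<Psi> N (\<lambda>k. zh k - (\<Sum>j=1..cseq.dim eigfuns. c j *s z j k)) = 0"
        by (rule eigenfunction_expansion[OF o b]) (use c in \<open>simp only: semi_inner_def\<close>)
    qed
  qed
  show ?thesis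
    by (rule exI[of _ "cseq.dim eigfuns"])
      (intro conjI num_eigenfunctions_eq_dim dim_eigfuns_le le0 impI[OF atkinson])
qed

end
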